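(* If $p$ is a prime number with $p\equiv 3 \bmod 4$, then $B_p/(P_p,P_p)$ contains a Frobenius group of order $p(p-1)/2$, which is non-abelian if $p>3$.
   Context: $B_p$ is the usual (Artin) braid group on $p$ strands, $P_p$ is the pure braid group, i.e. the kernel of the natural projection $B_p\to\mathfrak{S}_p$ onto the symmetric group, and $(P_p,P_p)$ is its commutator subgroup. A Frobenius group is a transitive permutation group on a finite set in which no non-trivial element fixes more than one point and some non-trivial element fixes a point; for $p=3$ the degenerate case of trivial point stabilizers (the cyclic group of order $3$) is allowed. *)

theory Defs
  imports
    "HOL-Algebra.Algebra"
    "HOL-Computational_Algebra.Primes"
begin

section \<open>The Artin braid group\<close>

text \<open>
  \<open>B\<^sub>n\<close> is given by Artin's presentation: generators
  \<open>\<sigma>\<^sub>1, \<dots>, \<sigma>\<^sub>n\<^sub>-\<^sub>1\<close>, subject to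
  \<open>\<sigma>\<^sub>i \<sigma>\<^sub>j = \<sigma>\<^sub>j \<sigma>\<^sub>i\<close> for \<open>\<bar>i - j\<bar> \<ge> 2\<close> and
  \<open>\<sigma>\<^sub>i \<sigma>\<^sub>i\<^sub>+\<^sub>1 \<sigma>\<^sub>i = \<sigma>\<^sub>i\<^sub>+\<^sub>1 \<sigma>\<^sub>i \<sigma>\<^sub>i\<^sub>+\<^sub>1\<close>.
  The letter \<open>(i, True)\<close> stands for \<open>\<sigma>\<^sub>i\<close> and \<open>(i, False)\<close> for its inverse.
\<close>

type_synonym braid_word = "(nat \<times> bool) list"

definition braid_words :: "nat \<Rightarrow> braid_word set"
  where "braid_words n = lists ({1..<n} \<times> UNIV)"

inductive braid_eq :: "nat \<Rightarrow> braid_word \<Rightarrow> braid_word \<Rightarrow> bool" for n where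
  refl: "u \<in> braid_words n \<Longrightarrow> braid_eq n u u"
| sym: "braid_eq n u v \<Longrightarrow> braid_eq n v u"
| trans: "braid_eq n u v \<Longrightarrow> braid_eq n v w \<Longrightarrow> braid_eq n u w"
| congr: "braid_eq n u v \<Longrightarrow> x \<in> braid_words n \<Longrightarrow> y \<in> braid_words n
    \<Longrightarrow> braid_eq n (x @ u @ y) (x @ v @ y)"
| cancel: "1 \<le> i \<Longrightarrow> i < n \<Longrightarrow> braid_eq n [(i, e), (i, \<not> e)] []"
| commute: "1 \<le> i \<Longrightarrow> i + 2 \<le> j \<Longrightarrow> j < n
    \<Longrightarrow> braid_eq n [(i, True), (j, True)] [(j, True), (i, True)]"
| braid: "1 \<le> i \<Longrightarrow> i + 1 < n
    \<Longrightarrow> braid_eq n [(i, True), (i + 1, True), (i, True)]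
                   [(i + 1, True), (i, True), (i + 1, True)]"

definition braid_rel :: "nat \<Rightarrow> (braid_word \<times> braid_word) set"
  where "braid_rel n = {(u, v). braid_eq n u v}"

definition braid_group :: "nat \<Rightarrow> braid_word set monoid"
  where "braid_group n =
    \<lparr> carrier = braid_words n // braid_rel n,
      monoid.mult = (\<lambda>A B. \<Union>u\<in>A. \<Union>v\<in>B. braid_rel n `` {u @ v}),
      one = braid_rel n `` {[]} \<rparr>"

lemma braid_words_simps [simp]:
  "[] \<in> braid_words n"
  "x # u \<in> braid_words n \<longleftrightarrow> 1 \<le> fst x \<and> fst x < n \<and> u \<in> braid_words n"
  "u @ v \<in> braid_words n \<longleftrightarrow> u \<in> braid_words n \<and> v \<in> braid_words n"
  "rev u \<in> braid_words n \<longleftrightarrow> u \<in> braid_words n"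
  by (auto simp: braid_words_def mem_Times_iff)

lemma braid_eq_words: "braid_eq n u v \<Longrightarrow> u \<in> braid_words n \<and> v \<in> braid_words n"
  by (induction rule: braid_eq.induct) auto

lemma equiv_braid_rel: "equiv (braid_words n) (braid_rel n)"
  by (rule equivI)
    (auto simp: braid_rel_def refl_on_def sym_def trans_def
      dest: braid_eq_words intro: braid_eq.intros)

lemma braid_class_eq:
  "braid_eq n u v \<Longrightarrow> braid_rel n `` {u} = braid_rel n `` {v}"
  using equiv_class_eq[OF equiv_braid_rel] by (simp add: braid_rel_def)

lemma braid_class_mem: "u \<in> braid_words n \<Longrightarrow> u \<in> braid_rel n `` {u}"
  by (simp add: braid_rel_def braid_eq.refl)

lemma braid_eq_append:
  assumes "braid_eq n u u'" "braid_eq n v v'"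
  shows "braid_eq n (u @ v) (u' @ v')"
  using assms braid_eq.congr[of n u u' "[]" v] braid_eq.congr[of n v v' u' "[]"]
  by (auto dest: braid_eq_words intro: braid_eq.trans)

lemma carrier_braid_group: "carrier (braid_group n) = braid_words n // braid_rel n"
  by (simp add: braid_group_def)

lemma mult_braid_group:
  assumes "u \<in> braid_words n" "v \<in> braid_words n"
  shows "(braid_rel n `` {u}) \<otimes>\<^bsub>braid_group n\<^esub> (braid_rel n `` {v}) = braid_rel n `` {u @ v}"
proof -
  have "braid_rel n `` {u' @ v'} = braid_rel n `` {u @ v}"
    if "u' \<in> braid_rel n `` {u}" "v' \<in> braid_rel n `` {v}" for u' v'
  proof -
    have "braid_eq n u u'" "braid_eq n v v'"
      using that by (simp_all add: braid_rel_def)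
    from braid_class_eq[OF braid_eq_append[OF this]] show ?thesis by (rule HOL.sym)
  qed
  then have "(\<Union>u'\<in>braid_rel n `` {u}. \<Union>v'\<in>braid_rel n `` {v}. braid_rel n `` {u' @ v'})
      = (\<Union>u'\<in>braid_rel n `` {u}. \<Union>v'\<in>braid_rel n `` {v}. braid_rel n `` {u @ v})"
    by (intro SUP_cong HOL.refl)
  also have "\<dots> = braid_rel n `` {u @ v}"
    using assms[THEN braid_class_mem] by blast
  finally show ?thesis
    by (simp add: braid_group_def)
qed

lemma braid_eq_inverse:
  "u \<in> braid_words n \<Longrightarrow> braid_eq n (rev (map (\<lambda>(i, e). (i, \<not> e)) u) @ u) []"
proof (induction u)
  case Nil
  then show ?case by (simp add: braid_eq.refl)
next
  case (Cons x u)
  obtain i e where x: "x = (i, e)" by force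
  let ?v = "rev (map (\<lambda>(i, e). (i, \<not> e)) u)"
  have v: "?v \<in> braid_words n" "u \<in> braid_words n"
    using braid_eq_words[OF Cons.IH] Cons.prems by auto
  have "braid_eq n [(i, \<not> e), (i, e)] []"
    using Cons.prems braid_eq.cancel[of i n "\<not> e"] by (simp add: x)
  from braid_eq.congr[OF this v]
  show ?case using Cons by (auto simp: x intro: braid_eq.trans)
qed

lemma group_braid_group: "group (braid_group n)"
proof (rule groupI)
  fix A B C
  assume "A \<in> carrier (braid_group n)" "B \<in> carrier (braid_group n)" "C \<in> carrier (braid_group n)"
  then obtain u v w where "u \<in> braid_words n" "v \<in> braid_words n" "w \<in> braid_words n"
    "A = braid_rel n `` {u}" "B = braid_rel n `` {v}" "C = braid_rel n `` {w}"
    by (auto simp: carrier_braid_group elim!: quotientE)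
  then show "A \<otimes>\<^bsub>braid_group n\<^esub> B \<otimes>\<^bsub>braid_group n\<^esub> C = A \<otimes>\<^bsub>braid_group n\<^esub> (B \<otimes>\<^bsub>braid_group n\<^esub> C)"
    by (simp add: mult_braid_group)
next
  have one: "\<one>\<^bsub>braid_group n\<^esub> = braid_rel n `` {[]}"
    by (simp add: braid_group_def)
  then show "\<one>\<^bsub>braid_group n\<^esub> \<in> carrier (braid_group n)"
    by (simp add: carrier_braid_group quotientI)
  fix A
  assume "A \<in> carrier (braid_group n)"
  then obtain u where u: "u \<in> braid_words n" "A = braid_rel n `` {u}"
    by (auto simp: carrier_braid_group elim!: quotientE)
  then show "\<one>\<^bsub>braid_group n\<^esub> \<otimes>\<^bsub>braid_group n\<^esub> A = A"
    by (simp add: one mult_braid_group)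
  let ?v = "rev (map (\<lambda>(i, e). (i, \<not> e)) u)"
  have eq: "braid_eq n (?v @ u) []" using u braid_eq_inverse by blast
  then have "?v \<in> braid_words n" using braid_eq_words by fastforce
  then show "\<exists>B\<in>carrier (braid_group n). B \<otimes>\<^bsub>braid_group n\<^esub> A = \<one>\<^bsub>braid_group n\<^esub>"
    using u braid_class_eq[OF eq]
    by (intro bexI[of _ "braid_rel n `` {?v}"])
      (simp_all add: one mult_braid_group carrier_braid_group quotientI)
next
  fix A B
  assume "A \<in> carrier (braid_group n)" "B \<in> carrier (braid_group n)"
  then show "A \<otimes>\<^bsub>braid_group n\<^esub> B \<in> carrier (braid_group n)"
    by (auto simp: carrier_braid_group mult_braid_group quotientI elim!: quotientE)
qed

section \<open>The pure braid group\<close>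

primrec word_perm :: "braid_word \<Rightarrow> nat \<Rightarrow> nat" where
  "word_perm [] = id"
| "word_perm (x # w) = transpose (fst x) (fst x + 1) \<circ> word_perm w"

definition braid_perm :: "braid_word set \<Rightarrow> nat \<Rightarrow> nat"
  where "braid_perm A = the_elem (word_perm ` A)"

definition pure_braid_group :: "nat \<Rightarrow> braid_word set set"
  where "pure_braid_group n = kernel (braid_group n) (sym_group n) braid_perm"

lemma word_perm_append: "word_perm (u @ v) = word_perm u \<circ> word_perm v"
  by (induction u) (auto simp: o_assoc)

lemma word_perm_permutes: "u \<in> braid_words n \<Longrightarrow> word_perm u permutes {1..n}"
  by (induction u)
    (simp_all add: permutes_id permutes_compose permutes_swap_id)

lemma word_perm_cong: "braid_eq n u v \<Longrightarrow> word_perm u = word_perm v"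
  by (induction rule: braid_eq.induct)
    (auto simp: word_perm_append fun_eq_iff transpose_def)

lemma braid_perm_class: "u \<in> braid_words n \<Longrightarrow> braid_perm (braid_rel n `` {u}) = word_perm u"
proof -
  assume u: "u \<in> braid_words n"
  have "word_perm ` (braid_rel n `` {u}) = {word_perm u}"
    using braid_class_mem[OF u] by (auto simp: braid_rel_def dest: word_perm_cong)
  then show ?thesis by (simp add: braid_perm_def)
qed

lemma braid_perm_hom: "group_hom (braid_group n) (sym_group n) braid_perm"
proof (intro group_hom.intro group_hom_axioms.intro group_braid_group sym_group_is_group homI)
  fix A B
  assume "A \<in> carrier (braid_group n)" "B \<in> carrier (braid_group n)"
  then obtain u v where uv: "u \<in> braid_words n" "v \<in> braid_words n"
    "A = braid_rel n `` {u}" "B = braid_rel n `` {v}"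
    by (auto simp: carrier_braid_group elim!: quotientE)
  then show "braid_perm (A \<otimes>\<^bsub>braid_group n\<^esub> B) = braid_perm A \<otimes>\<^bsub>sym_group n\<^esub> braid_perm B"
    by (simp add: mult_braid_group braid_perm_class word_perm_append sym_group_mult)
  from uv show "braid_perm A \<in> carrier (sym_group n)"
    using word_perm_permutes by (simp add: braid_perm_class sym_group_carrier del: One_nat_def)
qed

lemma derived_pure_braid_group_normal:
  "derived (braid_group n) (pure_braid_group n) \<lhd> braid_group n"
  unfolding pure_braid_group_def
  by (intro group.derived_is_normal group_braid_group group_hom.normal_kernel
      braid_perm_hom)

section \<open>Frobenius groups\<close>

text \<open>
  An abstract group is called Frobenius if it is isomorphic to a permutation group of the required
  kind, i.e. if it has a faithful action with the corresponding properties. As the set acted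
  upon is finite, it is no restriction to take it to be a set of natural numbers.
\<close>

definition frobenius_action ::
    "('a, 'b) monoid_scheme \<Rightarrow> 'c set \<Rightarrow> ('a \<Rightarrow> 'c \<Rightarrow> 'c) \<Rightarrow> bool"
  where "frobenius_action G E \<phi> \<longleftrightarrow>
    finite E \<and> faithful_action G E \<phi> \<and> transitive_action G E \<phi> \<and>
    (\<forall>g \<in> carrier G - {\<one>\<^bsub>G\<^esub>}. \<forall>x \<in> E. \<forall>y \<in> E. \<phi> g x = x \<and> \<phi> g y = y \<longrightarrow> x = y) \<and>
    (\<exists>g \<in> carrier G - {\<one>\<^bsub>G\<^esub>}. \<exists>x \<in> E. \<phi> g x = x)"

definition frobenius_group :: "('a, 'b) monoid_scheme \<Rightarrow> bool"
  where "frobenius_group G \<longleftrightarrow> (\<exists>(E :: nat set) \<phi>. frobenius_action G E \<phi>)"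

text \<open>The degenerate case, in which all point stabilizers are trivial.\<close>

definition regular_action ::
    "('a, 'b) monoid_scheme \<Rightarrow> 'c set \<Rightarrow> ('a \<Rightarrow> 'c \<Rightarrow> 'c) \<Rightarrow> bool"
  where "regular_action G E \<phi> \<longleftrightarrow>
    finite E \<and> E \<noteq> {} \<and> faithful_action G E \<phi> \<and> transitive_action G E \<phi> \<and>
    (\<forall>x \<in> E. stabilizer G \<phi> x = {\<one>\<^bsub>G\<^esub>})"

definition degenerate_frobenius_group :: "('a, 'b) monoid_scheme \<Rightarrow> bool"
  where "degenerate_frobenius_group G \<longleftrightarrow> (\<exists>(E :: nat set) \<phi>. regular_action G E \<phi>)"

end

theory Submission
  imports Defs "HOL-Number_Theory.Cong"
begin

text \<open>
  The extension of the symmetric group by the abelianised pure braid group splits over every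
  subgroup of odd order, because twice its class vanishes. Reversal of words is an
  anti-automorphism \<open>\<rho>\<close> of the braid group that fixes each generator and induces inversion on
  the symmetric group, so \<open>x \<mapsto> x \<rho>(x)\<close> is a crossed homomorphism into the abelianised pure braid
  group. The pure braid group is the normal closure of the squares of the generators (this is
  the Coxeter presentation of the symmetric group), hence \<open>\<rho>\<close> acts trivially on its
  abelianisation and the crossed homomorphism restricts to squaring there: its values bound the
  double of the extension cocycle. The cocycle is also killed by the order of the subgroup, so it
  is a coboundary when that order is odd. For \<open>p \<equiv> 3\<close> modulo 4 the maps \<open>x \<mapsto> a x + b\<close>
  modulo \<open>p\<close> with \<open>a\<close> a nonzero square form a Frobenius group of odd order \<open>p (p - 1) / 2\<close>.
\<close>

section \<open>Splitting over groups of odd order\<close>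

text \<open>Summation over \<open>K\<close> makes the multiple \<open>2 * t + 1\<close> of
  \<open>c\<close> a coboundary, and \<open>square\<close> does the same for its double. As
  \<open>1 = (2 * t + 1) - t * 2\<close>, the cocycle \<open>c\<close> is itself a
  coboundary.\<close>

lemma (in comm_group) odd_order_trivializes_cocycle:
  fixes K (structure)
  assumes K: "group K" "finite (carrier K)" "order K = 2 * t + 1"
    and act: "\<And>g. g \<in> carrier K \<Longrightarrow> act g \<in> hom G G"
    and c: "\<And>g h. g \<in> carrier K \<Longrightarrow> h \<in> carrier K \<Longrightarrow> c g h \<in> carrier G"
    and cocycle: "\<And>g h k. g \<in> carrier K \<Longrightarrow> h \<in> carrier K \<Longrightarrow> k \<in> carrier K \<Longrightarrow>
      c g h \<otimes> c (g \<otimes>\<^bsub>K\<^esub> h) k = act g (c h k) \<otimes> c g (h \<otimes>\<^bsub>K\<^esub> k)"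
    and N: "\<And>g. g \<in> carrier K \<Longrightarrow> N g \<in> carrier G"
    and square: "\<And>g h. g \<in> carrier K \<Longrightarrow> h \<in> carrier K \<Longrightarrow>
      N g \<otimes> act g (N h) = c g h [^] (2::nat) \<otimes> N (g \<otimes>\<^bsub>K\<^esub> h)"
  obtains u where "\<And>g. g \<in> carrier K \<Longrightarrow> u g \<in> carrier G"
    and "\<And>g h. g \<in> carrier K \<Longrightarrow> h \<in> carrier K \<Longrightarrow>
      u g \<otimes> act g (u h) \<otimes> c g h = u (g \<otimes>\<^bsub>K\<^esub> h)"
proof -
  interpret K: group K by (rule K)
  \<comment> \<open>Summing the cocycle identity over \<open>k\<close> shows that \<open>f\<close> bounds the multiple \<open>2 t + 1\<close> of \<open>c\<close>,
    while \<open>N\<close> bounds its double.\<close>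
  define f where "f g = (\<Otimes>k\<in>carrier K. c g k)" for g
  \<comment> \<open>Additively \<open>u = - f + t N\<close>, with coboundary
    \<open>- (2 t + 1) c + 2 t c = - c\<close>. The sign is chosen so that multiplying a lift by
    \<open>u\<close> removes its factor set \<open>c\<close>.\<close>
  define u where "u g = inv (f g) \<otimes> N g [^] t" for g
  have f: "f g \<in> carrier G" if "g \<in> carrier K" for g
    unfolding f_def using that c by (intro finprod_closed) auto
  have hom: "group_hom G G (act g)" if "g \<in> carrier K" for g
    using act[OF that] by unfold_locales
  have sum_cocycle: "c g h [^] (2 * t + 1) \<otimes> f (g \<otimes>\<^bsub>K\<^esub> h) = act g (f h) \<otimes> f g"
    if g: "g \<in> carrier K" and h: "h \<in> carrier K" for g h
  proof -
    interpret act: group_hom G G "act g" by (rule hom[OF g])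
    have "c g h [^] (2 * t + 1) \<otimes> f (g \<otimes>\<^bsub>K\<^esub> h)
        = (\<Otimes>k\<in>carrier K. c g h \<otimes> c (g \<otimes>\<^bsub>K\<^esub> h) k)"
      using g h c K(3) by (simp add: f_def finprod_multf finprod_const order_def Pi_def)
    also have "\<dots> = (\<Otimes>k\<in>carrier K. act g (c h k) \<otimes> c g (h \<otimes>\<^bsub>K\<^esub> k))"
      using g h c cocycle by (intro finprod_cong) (auto simp: Pi_def)
    also have "\<dots> = (\<Otimes>k\<in>carrier K. act g (c h k)) \<otimes> (\<Otimes>k\<in>carrier K. c g (h \<otimes>\<^bsub>K\<^esub> k))"
      using g h c by (intro finprod_multf) (auto simp: Pi_def)
    also have "(\<Otimes>k\<in>carrier K. act g (c h k)) = act g (f h)"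
    proof -
      have "act g (\<Otimes>k\<in>J. c h k) = (\<Otimes>k\<in>J. act g (c h k))" if "finite J" "J \<subseteq> carrier K" for J
        using that by (induction J) (use g h c in \<open>auto simp: Pi_def subset_iff finprod_insert\<close>)
      then show ?thesis using K(2) by (simp add: f_def)
    qed
    \<comment> \<open>Left translation by \<open>h\<close> permutes \<open>K\<close>, so the product
      only needs reindexing.\<close>
    also have "(\<Otimes>k\<in>carrier K. c g (h \<otimes>\<^bsub>K\<^esub> k)) = f g"
      unfolding f_def
      using finprod_reindex[of "c g" "\<lambda>k. h \<otimes>\<^bsub>K\<^esub> k" "carrier K"] g h c
        K.surj_const_mult[OF h] K.inj_on_cmult[OF h] by (simp add: Pi_def)
    finally show ?thesis .
  qed
  show thesis
  proof (rule that)
    show "u g \<in> carrier G" if "g \<in> carrier K" for g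
      using that f N by (simp add: u_def)
    fix g h assume g: "g \<in> carrier K" and h: "h \<in> carrier K"
    then have gh: "g \<otimes>\<^bsub>K\<^esub> h \<in> carrier K" by simp
    interpret act: group_hom G G "act g" by (rule hom[OF g])
    note cl = f[OF g] f[OF h] f[OF gh] N[OF g] N[OF h] N[OF gh] c[OF g h]
    define C where "C = c g h [^] (2 * t + 1)"
    have C: "C \<in> carrier G" "(c g h [^] (2::nat)) [^] t \<otimes> c g h = C"
      using cl by (simp_all add: C_def nat_pow_pow)
    have "u g \<otimes> act g (u h) \<otimes> c g h
        = inv (act g (f h) \<otimes> f g) \<otimes> (N g \<otimes> act g (N h)) [^] t \<otimes> c g h"
      using cl by (simp add: u_def inv_mult nat_pow_distrib act.hom_nat_pow m_ac)
    also have "\<dots> = inv (C \<otimes> f (g \<otimes>\<^bsub>K\<^esub> h))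
        \<otimes> (c g h [^] (2::nat) \<otimes> N (g \<otimes>\<^bsub>K\<^esub> h)) [^] t \<otimes> c g h"
      by (simp only: sum_cocycle[OF g h] square[OF g h] C_def)
    also have "\<dots> = inv (f (g \<otimes>\<^bsub>K\<^esub> h)) \<otimes> N (g \<otimes>\<^bsub>K\<^esub> h) [^] t
        \<otimes> (inv C \<otimes> ((c g h [^] (2::nat)) [^] t \<otimes> c g h))"
      using cl C(1) by (simp add: inv_mult nat_pow_distrib m_ac)
    also have "\<dots> = u (g \<otimes>\<^bsub>K\<^esub> h)"
      unfolding C(2) using cl C(1) by (simp add: u_def)
    finally show "u g \<otimes> act g (u h) \<otimes> c g h = u (g \<otimes>\<^bsub>K\<^esub> h)" .
  qed
qed

text \<open>Here \<open>c\<close> is the factor set of the lift \<open>\<tau>\<close> relative to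
  the abelian normal subgroup \<open>A\<close>, and \<open>square\<close> says that \<open>N\<close>
  bounds its double for the conjugation action. The preceding lemma then yields the correction
  \<open>u\<close> that turns \<open>\<tau>\<close> into a homomorphism.\<close>

lemma (in group) odd_order_lifts:
  fixes K (structure)
  assumes K: "group K" "finite (carrier K)" "odd (order K)"
    and A: "subgroup A G"
    and comm: "\<And>a b. a \<in> A \<Longrightarrow> b \<in> A \<Longrightarrow> a \<otimes> b = b \<otimes> a"
    and conj: "\<And>x a. x \<in> carrier G \<Longrightarrow> a \<in> A \<Longrightarrow> x \<otimes> a \<otimes> inv x \<in> A"
    and tau: "\<And>g. g \<in> carrier K \<Longrightarrow> \<tau> g \<in> carrier G"
    and c: "\<And>g h. g \<in> carrier K \<Longrightarrow> h \<in> carrier K \<Longrightarrow> c g h \<in> A"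
    and tau_mult: "\<And>g h. g \<in> carrier K \<Longrightarrow> h \<in> carrier K \<Longrightarrow>
      \<tau> g \<otimes> \<tau> h = c g h \<otimes> \<tau> (g \<otimes>\<^bsub>K\<^esub> h)"
    and N: "\<And>g. g \<in> carrier K \<Longrightarrow> N g \<in> A"
    and square: "\<And>g h. g \<in> carrier K \<Longrightarrow> h \<in> carrier K \<Longrightarrow>
      N g \<otimes> (\<tau> g \<otimes> N h \<otimes> inv (\<tau> g)) = c g h \<otimes> c g h \<otimes> N (g \<otimes>\<^bsub>K\<^esub> h)"
  obtains u where "\<And>g. g \<in> carrier K \<Longrightarrow> u g \<in> A" "(\<lambda>g. u g \<otimes> \<tau> g) \<in> hom K G"
proof -
  interpret K: group K by (rule K)
  interpret A: subgroup A G by (rule A)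
  let ?A = "G\<lparr>carrier := A\<rparr>"
  have "group ?A" using A.subgroup_is_group by (simp add: is_group)
  then interpret A: comm_group ?A
    using comm by (intro group.group_comm_groupI) auto
  define act where "act g a = \<tau> g \<otimes> a \<otimes> inv (\<tau> g)" for g a
  obtain t where t: "order K = 2 * t + 1" using K(3) by (auto elim: oddE)
  have act_mult: "act g (a \<otimes> b) = act g a \<otimes> act g b"
    if "g \<in> carrier K" "a \<in> A" "b \<in> A" for g a b
    using that tau A.mem_carrier by (simp add: act_def m_assoc inv_solve_left)
  have act_A: "act g a \<in> A" if "g \<in> carrier K" "a \<in> A" for g a
    using that tau conj by (simp add: act_def)
  have act_tau: "act g a \<otimes> \<tau> g = \<tau> g \<otimes> a" if "g \<in> carrier K" "a \<in> A" for g a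
    using that tau A.mem_carrier by (simp add: act_def m_assoc)
  have cocycle: "c g h \<otimes> c (g \<otimes>\<^bsub>K\<^esub> h) k = act g (c h k) \<otimes> c g (h \<otimes>\<^bsub>K\<^esub> k)"
    if g: "g \<in> carrier K" and h: "h \<in> carrier K" and k: "k \<in> carrier K" for g h k
  proof -
    let ?T = "\<tau> (g \<otimes>\<^bsub>K\<^esub> h \<otimes>\<^bsub>K\<^esub> k)"
    note cl = A.mem_carrier[OF c] tau A.mem_carrier[OF act_A]
    \<comment> \<open>After multiplication by \<open>?T\<close> on the right, the two sides come
      from the two bracketings of
      \<open>\<tau> g \<otimes> \<tau> h \<otimes> \<tau> k\<close>.\<close>
    have "c g h \<otimes> c (g \<otimes>\<^bsub>K\<^esub> h) k \<otimes> ?T = c g h \<otimes> \<tau> (g \<otimes>\<^bsub>K\<^esub> h) \<otimes> \<tau> k"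
      using g h k by (simp add: cl m_assoc tau_mult)
    also have "\<dots> = \<tau> g \<otimes> \<tau> h \<otimes> \<tau> k"
      using g h k by (simp only: tau_mult)
    also have "\<dots> = \<tau> g \<otimes> c h k \<otimes> \<tau> (h \<otimes>\<^bsub>K\<^esub> k)"
      using g h k by (simp add: cl m_assoc tau_mult[OF h k])
    also have "\<dots> = act g (c h k) \<otimes> c g (h \<otimes>\<^bsub>K\<^esub> k) \<otimes> ?T"
      using g h k by (simp add: cl c m_assoc tau_mult K.m_assoc flip: act_tau)
    finally show ?thesis
      using g h k by (simp add: cl c)
  qed
  obtain u where u: "\<And>g. g \<in> carrier K \<Longrightarrow> u g \<in> A"
    and u_mult: "\<And>g h. g \<in> carrier K \<Longrightarrow> h \<in> carrier K \<Longrightarrow>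
      u g \<otimes> act g (u h) \<otimes> c g h = u (g \<otimes>\<^bsub>K\<^esub> h)"
  proof (rule A.odd_order_trivializes_cocycle[OF K(1,2) t, of act c N])
    show "act g \<in> hom ?A ?A" if "g \<in> carrier K" for g
      using that act_A act_mult by (auto intro!: homI)
    show "N g \<otimes>\<^bsub>?A\<^esub> act g (N h) = c g h [^]\<^bsub>?A\<^esub> (2::nat) \<otimes>\<^bsub>?A\<^esub> N (g \<otimes>\<^bsub>K\<^esub> h)"
      if "g \<in> carrier K" "h \<in> carrier K" for g h
      using that square[OF that] c[OF that] by (simp add: act_def numeral_2_eq_2)
  qed (use c N cocycle in auto)
  show thesis
  proof (rule that[OF u], assumption, rule homI)
    show "u g \<otimes> \<tau> g \<in> carrier G" if "g \<in> carrier K" for g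
      using that u tau A.mem_carrier by simp
    fix g h assume g: "g \<in> carrier K" and h: "h \<in> carrier K"
    note cl = A.mem_carrier[OF c] tau A.mem_carrier[OF act_A] A.mem_carrier[OF u]
    \<comment> \<open>Moving \<open>\<tau> g\<close> past \<open>u h\<close> replaces
      \<open>u h\<close> by \<open>act g (u h)\<close>; the factor \<open>c g h\<close> of
      \<open>\<tau> g \<otimes> \<tau> h\<close> then completes the left side of
      \<open>u_mult\<close>.\<close>
    have "u g \<otimes> \<tau> g \<otimes> (u h \<otimes> \<tau> h) = u g \<otimes> (\<tau> g \<otimes> u h) \<otimes> \<tau> h"
      using g h by (simp add: cl m_assoc)
    also have "\<dots> = u g \<otimes> act g (u h) \<otimes> (\<tau> g \<otimes> \<tau> h)"
      using g h by (simp add: cl u m_assoc flip: act_tau)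
    also have "\<dots> = u (g \<otimes>\<^bsub>K\<^esub> h) \<otimes> \<tau> (g \<otimes>\<^bsub>K\<^esub> h)"
      using g h by (simp add: cl u tau_mult m_assoc flip: u_mult)
    finally show "u (g \<otimes>\<^bsub>K\<^esub> h) \<otimes> \<tau> (g \<otimes>\<^bsub>K\<^esub> h) = u g \<otimes> \<tau> g \<otimes> (u h \<otimes> \<tau> h)" ..
  qed
qed

section \<open>The Coxeter presentation of the symmetric group\<close>

definition (in monoid) list_prod :: "'a list \<Rightarrow> 'a"
  where "list_prod xs = foldr (\<otimes>) xs \<one>"

context monoid
begin

lemma list_prod_Nil [simp]: "list_prod [] = \<one>"
  and list_prod_Cons [simp]: "list_prod (x # xs) = x \<otimes> list_prod xs"
  by (simp_all add: list_prod_def)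

lemma list_prod_closed [simp]: "set xs \<subseteq> carrier G \<Longrightarrow> list_prod xs \<in> carrier G"
  by (induction xs) auto

lemma list_prod_append:
  "set xs \<subseteq> carrier G \<Longrightarrow> set ys \<subseteq> carrier G \<Longrightarrow>
    list_prod (xs @ ys) = list_prod xs \<otimes> list_prod ys"
  by (induction xs) (auto simp: m_assoc)

lemma list_prod_commute:
  "x \<in> carrier G \<Longrightarrow> set ys \<subseteq> carrier G \<Longrightarrow> (\<And>y. y \<in> set ys \<Longrightarrow> x \<otimes> y = y \<otimes> x) \<Longrightarrow>
    x \<otimes> list_prod ys = list_prod ys \<otimes> x"
proof (induction ys)
  case (Cons y ys)
  have "x \<otimes> (y \<otimes> list_prod ys) = x \<otimes> y \<otimes> list_prod ys"
    using Cons.prems(1,2) by (simp add: m_assoc)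
  also have "\<dots> = y \<otimes> x \<otimes> list_prod ys"
    using Cons.prems(3)[of y] by simp
  also have "\<dots> = y \<otimes> list_prod ys \<otimes> x"
    using Cons.IH Cons.prems(1,2) Cons.prems(3)[OF list.set_intros(2)] by (simp add: m_assoc)
  finally show ?case by simp
qed simp

end

text \<open>An arbitrary group with elements that satisfy the Coxeter relations. It will be
  instantiated with a quotient of the braid group, about which it must be shown that words with
  trivial permutation vanish there.\<close>

locale coxeter_images = group G for G (structure) +
  fixes n :: nat and s :: "nat \<Rightarrow> 'a"
  assumes s_closed [simp]: "1 \<le> i \<Longrightarrow> i < n \<Longrightarrow> s i \<in> carrier G"
    and s_square: "1 \<le> i \<Longrightarrow> i < n \<Longrightarrow> s i \<otimes> s i = \<one>"
    and s_commute: "1 \<le> i \<Longrightarrow> i + 2 \<le> j \<Longrightarrow> j < n \<Longrightarrow> s i \<otimes> s j = s j \<otimes> s i"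
    and s_braid: "1 \<le> i \<Longrightarrow> i + 1 < n \<Longrightarrow>
      s i \<otimes> (s (i + 1) \<otimes> s i) = s (i + 1) \<otimes> (s i \<otimes> s (i + 1))"
begin

definition ev :: "nat list \<Rightarrow> 'a" where "ev w = list_prod (map s w)"

lemma ev_Nil [simp]: "ev [] = \<one>"
  and ev_Cons [simp]: "ev (i # w) = s i \<otimes> ev w"
  by (simp_all add: ev_def)

lemma map_s_closed: "set w \<subseteq> {1..<n} \<Longrightarrow> set (map s w) \<subseteq> carrier G"
  by fastforce

lemma ev_closed [simp]: "set w \<subseteq> {1..<n} \<Longrightarrow> ev w \<in> carrier G"
  unfolding ev_def by (intro list_prod_closed map_s_closed)

lemma ev_append: "set u \<subseteq> {1..<n} \<Longrightarrow> set v \<subseteq> {1..<n} \<Longrightarrow> ev (u @ v) = ev u \<otimes> ev v"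
  unfolding ev_def map_append by (intro list_prod_append map_s_closed)

lemma s_commute_ev:
  assumes "1 \<le> i" "i < n" "set w \<subseteq> {1..<n}" "\<And>j. j \<in> set w \<Longrightarrow> i + 2 \<le> j \<or> j + 2 \<le> i"
  shows "s i \<otimes> ev w = ev w \<otimes> s i"
  unfolding ev_def
proof (rule list_prod_commute)
  fix y assume "y \<in> set (map s w)"
  then obtain j where "j \<in> set w" "y = s j" by auto
  then show "s i \<otimes> y = y \<otimes> s i"
    using assms(1-3) assms(4)[of j] s_commute[of i j] s_commute[of j i] by fastforce
qed (use assms map_s_closed in auto)

text \<open>
  \<open>cyc k j\<close> is \<open>s\<^sub>k\<^sub>-\<^sub>1 \<dots> s\<^sub>j\<close>; it maps \<open>j\<close> to \<open>k\<close>, and for \<open>1 \<le> j \<le> k\<close> these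
  elements represent the cosets of the subgroup generated by \<open>s\<^sub>1, \<dots>, s\<^sub>k\<^sub>-\<^sub>2\<close>.
\<close>

definition cyc :: "nat \<Rightarrow> nat \<Rightarrow> 'a" where "cyc k j = ev (rev [j..<k])"

lemma cyc_closed [simp]: "1 \<le> j \<Longrightarrow> k \<le> n \<Longrightarrow> cyc k j \<in> carrier G"
  unfolding cyc_def by (rule ev_closed) auto

lemma cyc_split: "1 \<le> j \<Longrightarrow> j \<le> i \<Longrightarrow> i \<le> k \<Longrightarrow> k \<le> n \<Longrightarrow> cyc k j = cyc k i \<otimes> cyc i j"
  unfolding cyc_def using upt_add_eq_append[of j i "k - i"]
  by (subst ev_append [symmetric]) (auto simp flip: rev_append)

lemma cyc_Suc: "1 \<le> j \<Longrightarrow> j < n \<Longrightarrow> cyc (Suc j) j = s j"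
  by (simp add: cyc_def)

lemma cyc_same [simp]: "cyc j j = \<one>"
  by (simp add: cyc_def)

text \<open>Isolate the factors \<open>s (i + 1)\<close> and \<open>s i\<close> of
  \<open>cyc k j\<close>. The new letter commutes with everything to their right, the braid relation
  turns it into an \<open>s i\<close> in front of them, and this commutes with everything to their
  left.\<close>

lemma cyc_exchange:
  assumes "1 \<le> j" "j \<le> i" "i + 1 < k" "k \<le> n"
  shows "cyc k j \<otimes> s (i + 1) = s i \<otimes> cyc k j"
proof -
  have comm1: "s (i + 1) \<otimes> cyc i j = cyc i j \<otimes> s (i + 1)"
    unfolding cyc_def using assms by (intro s_commute_ev) auto
  have comm2: "s i \<otimes> cyc k (i + 2) = cyc k (i + 2) \<otimes> s i"
    unfolding cyc_def using assms by (intro s_commute_ev) auto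
  have "cyc k j = cyc k (i + 2) \<otimes> cyc (i + 2) j"
    using assms by (intro cyc_split) auto
  also have "cyc (i + 2) j = cyc (i + 2) (i + 1) \<otimes> cyc (i + 1) j"
    using assms by (intro cyc_split) auto
  also have "cyc (i + 1) j = cyc (i + 1) i \<otimes> cyc i j"
    using assms by (intro cyc_split) auto
  finally have eq: "cyc k j = cyc k (i + 2) \<otimes> (s (i + 1) \<otimes> (s i \<otimes> cyc i j))"
    using assms cyc_Suc[of i] cyc_Suc[of "i + 1"] by simp
  have "cyc k j \<otimes> s (i + 1) = cyc k (i + 2) \<otimes> ((s (i + 1) \<otimes> (s i \<otimes> s (i + 1))) \<otimes> cyc i j)"
    using assms by (simp add: eq m_assoc comm1[symmetric, simplified])
  also have "\<dots> = cyc k (i + 2) \<otimes> ((s i \<otimes> (s (i + 1) \<otimes> s i)) \<otimes> cyc i j)"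
    using assms s_braid[of i] by simp
  also have "\<dots> = (cyc k (i + 2) \<otimes> s i) \<otimes> (s (i + 1) \<otimes> (s i \<otimes> cyc i j))"
    using assms by (simp add: m_assoc)
  also have "\<dots> = s i \<otimes> cyc k j"
    unfolding eq comm2 [symmetric] using assms by (simp add: m_assoc)
  finally show ?thesis .
qed

text \<open>The set of products \<open>ev v \<otimes> cyc k j\<close> is closed under right
  multiplication by each generator \<open>s i\<close>: for \<open>j = Suc i\<close> or
  \<open>i = j\<close> the representative changes to its neighbour, and otherwise \<open>s i\<close>
  passes through \<open>cyc k j\<close>, unchanged if \<open>Suc i < j\<close> and as
  \<open>s (i - 1)\<close> if \<open>j < i\<close>.\<close>

lemma ev_coset_representative:
  assumes "set w \<subseteq> {1..<k}" "1 \<le> k" "k \<le> n"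
  shows "\<exists>v j. set v \<subseteq> {1..<k - 1} \<and> 1 \<le> j \<and> j \<le> k \<and> ev w = ev v \<otimes> cyc k j"
  using assms(1)
proof (induction w rule: rev_induct)
  case Nil
  show ?case using assms by (intro exI[of _ "[]"] exI[of _ k]) simp
next
  case (snoc i w)
  then obtain v j where v: "set v \<subseteq> {1..<k - 1}" and j: "1 \<le> j" "j \<le> k"
    and eq: "ev w = ev v \<otimes> cyc k j" by auto
  have i: "1 \<le> i" "i < k" and w: "set w \<subseteq> {1..<k}" using snoc.prems by auto
  have wn: "set w \<subseteq> {1..<n}" and vn: "set v \<subseteq> {1..<n}" using assms(3) by (auto dest!: subsetD[OF w] subsetD[OF v])
  have ev: "ev (w @ [i]) = ev v \<otimes> (cyc k j \<otimes> s i)"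
    using wn vn i j assms by (simp add: ev_append eq m_assoc)
  have ev_snoc: "ev (v @ [l]) = ev v \<otimes> s l" if "1 \<le> l" "l < n" for l
    using that vn by (simp add: ev_append)
  consider "j = Suc i" | "i = j" | "Suc i < j" | "j < i" by linarith
  then show ?case
  proof cases
    case 1
    then have "cyc k j \<otimes> s i = cyc k i"
      using i j assms cyc_split[of i j k] by (simp add: cyc_Suc)
    then show ?thesis using ev v i by (metis less_imp_le)
  next
    case 2
    have "cyc k j = cyc k (Suc j) \<otimes> s j"
      using 2 i j assms cyc_split[of j "Suc j" k] by (simp add: cyc_Suc)
    then have "cyc k j \<otimes> s i = cyc k (Suc j)"
      using 2 i j assms by (simp add: m_assoc s_square)
    then show ?thesis using ev v i 2 by (metis Suc_leI le_SucI)
  next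
    case 3
    have "s i \<otimes> cyc k j = cyc k j \<otimes> s i"
      unfolding cyc_def using 3 i j assms by (intro s_commute_ev) auto
    then have "ev (w @ [i]) = ev (v @ [i]) \<otimes> cyc k j"
      using ev i j vn assms by (simp add: ev_snoc m_assoc)
    then show ?thesis
      using v i j 3 by (intro exI[of _ "v @ [i]"] exI[of _ j]) auto
  next
    case 4
    have "cyc k j \<otimes> s i = s (i - 1) \<otimes> cyc k j"
      using cyc_exchange[of j "i - 1" k] 4 i j assms by simp
    then have "ev (w @ [i]) = ev (v @ [i - 1]) \<otimes> cyc k j"
      using ev i j 4 vn assms by (simp add: ev_snoc m_assoc)
    then show ?thesis
      using v i j 4 by (intro exI[of _ "v @ [i - 1]"] exI[of _ j]) auto
  qed
qed

text \<open>Induction on the bound \<open>k\<close> for the letters: a word with trivial permutation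
  lies in the trivial coset, hence equals a word in fewer generators. So the Coxeter relations
  already force every relation between adjacent transpositions.\<close>

lemma ev_eq_one:
  assumes \<pi>: "\<pi> \<in> hom G (sym_group n)"
    and \<pi>_s: "\<And>i. 1 \<le> i \<Longrightarrow> i < n \<Longrightarrow> \<pi> (s i) = transpose i (Suc i)"
    and "set w \<subseteq> {1..<k}" "k \<le> n" "\<pi> (ev w) = id"
  shows "ev w = \<one>"
  using assms(3-)
proof (induction k arbitrary: w)
  case 0
  then show ?case by simp
next
  case (Suc k)
  interpret \<pi>: group_hom G "sym_group n" \<pi>
    using \<pi> by (intro group_hom.intro group_hom_axioms.intro is_group sym_group_is_group)
  \<comment> \<open>The letters of \<open>v\<close> are at most \<open>l - 2\<close>, so their
    transpositions involve only points up to \<open>l - 1\<close>.\<close>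
  have top: "\<pi> (ev v) l = l" if "set v \<subseteq> {1..<l - 1}" "l \<le> n" for v l
    using that(1)
  proof (induction v)
    case (Cons a v)
    have "set v \<subseteq> {1..<n}" using Cons.prems that(2) by fastforce
    with Cons that(2) show ?case
      by (auto simp: sym_group_mult \<pi>_s transpose_def)
  qed (simp add: sym_group_one)
  have cycle: "\<pi> (cyc l j) j = l" if "1 \<le> j" "j \<le> l" "l \<le> n" for l j
    using that(2,3)
  proof (induction l rule: dec_induct)
    case base
    then show ?case by (simp add: sym_group_one)
  next
    case (step l)
    have "cyc (Suc l) j = s l \<otimes> cyc l j"
      using step that cyc_split[of j l "Suc l"] by (simp add: cyc_Suc)
    with step that show ?case by (simp add: sym_group_mult \<pi>_s)
  qed
  obtain v j where v: "set v \<subseteq> {1..<k}" and j: "1 \<le> j" "j \<le> Suc k"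
    and eq: "ev w = ev v \<otimes> cyc (Suc k) j"
    using ev_coset_representative[of w "Suc k"] Suc.prems by auto
  have vn: "set v \<subseteq> {1..<n}" using v Suc.prems by auto
  \<comment> \<open>The identity fixes \<open>j\<close>, while \<open>cyc (Suc k) j\<close> sends
    \<open>j\<close> to \<open>Suc k\<close> and \<open>ev v\<close> fixes \<open>Suc k\<close>.
    Hence \<open>j = Suc k\<close>, and the factor \<open>cyc\<close> is trivial.\<close>
  have "j = \<pi> (ev w) j" using Suc.prems by simp
  also have "\<dots> = \<pi> (ev v) (\<pi> (cyc (Suc k) j) j)"
    using vn j Suc.prems(2) by (simp add: eq sym_group_mult)
  also have "\<dots> = Suc k"
    using cycle[OF j Suc.prems(2)] top[of v "Suc k"] v Suc.prems by simp
  finally have "ev w = ev v"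
    using eq vn by simp
  with Suc.IH[of v] Suc.prems v show ?case by simp
qed

end

section \<open>Extensions with a compatible anti-endomorphism\<close>

text \<open>Products in quotient groups stay in group notation, so that simplification uses the
  group laws and the homomorphism \<open>\<phi>\<close> instead of products of cosets.\<close>

declare mult_FactGroup [simp del] one_FactGroup [simp del]

text \<open>In the application \<open>\<pi>\<close> is the permutation of a braid and
  \<open>\<rho>\<close> is reversal of words. The axiom \<open>\<pi>_rho\<close> places every
  \<open>x \<otimes> \<rho> x\<close> in the kernel of \<open>\<pi>\<close>.\<close>

locale anti_endo_extension = group_hom G H \<pi> for G (structure) and H (structure) and \<pi> +
  fixes \<rho> :: "'a \<Rightarrow> 'a"
  assumes rho_closed [simp]: "x \<in> carrier G \<Longrightarrow> \<rho> x \<in> carrier G"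
    and rho_mult: "x \<in> carrier G \<Longrightarrow> y \<in> carrier G \<Longrightarrow> \<rho> (x \<otimes> y) = \<rho> y \<otimes> \<rho> x"
    and \<pi>_rho: "x \<in> carrier G \<Longrightarrow> \<pi> (\<rho> x) = inv\<^bsub>H\<^esub> \<pi> x"
begin

definition P where "P = kernel G H \<pi>"
definition D where "D = derived G P"
definition \<phi> where "\<phi> x = D #> x"

lemma P_normal: "P \<lhd> G"
  unfolding P_def by (rule normal_kernel)

lemma D_normal: "D \<lhd> G"
  unfolding D_def by (rule G.derived_is_normal[OF P_normal])

lemma P_subgroup: "subgroup P G" and D_subgroup: "subgroup D G"
  using P_normal D_normal normal_imp_subgroup by auto

sublocale Q: group "G Mod D" by (rule normal.factorgroup_is_group[OF D_normal])
sublocale \<phi>: group_hom G "G Mod D" \<phi>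
proof -
  have "\<phi> = (#>) D" by (simp add: \<phi>_def fun_eq_iff)
  then have "\<phi> \<in> hom G (G Mod D)" using normal.r_coset_hom_Mod[OF D_normal] by simp
  then show "group_hom G (G Mod D) \<phi>"
    by (intro group_hom.intro group_hom_axioms.intro G.is_group Q.is_group)
qed

lemma mem_P: "x \<in> P \<longleftrightarrow> x \<in> carrier G \<and> \<pi> x = \<one>\<^bsub>H\<^esub>"
  by (simp add: P_def kernel_def)

lemma D_subset_P: "D \<subseteq> P"
  unfolding D_def by (rule G.derived_incl[OF order_refl P_subgroup])

lemma cancel:
  assumes "x \<in> carrier G" "y \<in> carrier G"
  shows "x \<otimes> (inv x \<otimes> y) = y" "inv x \<otimes> (x \<otimes> y) = y"
  using assms by (simp_all flip: G.m_assoc)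

lemma \<phi>_eqI:
  assumes "x \<in> carrier G" "y \<in> carrier G" "x \<otimes> inv y \<in> D"
  shows "\<phi> x = \<phi> y"
proof -
  have "x \<otimes> inv y \<otimes> y \<in> D #> y"
    using assms subgroup.subset[OF D_subgroup] by (intro G.rcosI)
  then have "x \<in> D #> y" using assms by (simp add: G.m_assoc)
  then have "D #> y = D #> x"
    using assms(2) by (intro G.repr_independence D_subgroup)
  then show ?thesis by (simp add: \<phi>_def)
qed

lemma \<pi>_eq_if_\<phi>_eq:
  assumes "x \<in> carrier G" "y \<in> carrier G" "\<phi> x = \<phi> y"
  shows "\<pi> x = \<pi> y"
proof -
  have "x \<in> D #> y"
    using assms G.rcos_self[OF assms(1) D_subgroup] by (simp add: \<phi>_def)
  then obtain d where "d \<in> D" "x = d \<otimes> y" by (auto simp: r_coset_def)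
  then show ?thesis using D_subset_P assms by (auto simp: mem_P)
qed

lemma \<phi>_commute:
  assumes "a \<in> P" "b \<in> P"
  shows "\<phi> a \<otimes>\<^bsub>G Mod D\<^esub> \<phi> b = \<phi> b \<otimes>\<^bsub>G Mod D\<^esub> \<phi> a"
proof -
  have ab: "a \<in> carrier G" "b \<in> carrier G" using assms by (auto simp: mem_P)
  have "a \<otimes> b \<otimes> inv a \<otimes> inv b \<in> D"
    unfolding D_def derived_def using assms by (intro generate.incl) auto
  then have "\<phi> (a \<otimes> b) = \<phi> (b \<otimes> a)"
    using ab by (intro \<phi>_eqI) (simp_all add: G.inv_mult_group G.m_assoc)
  then show ?thesis using ab by simp
qed

lemma mult_rho_P: "x \<in> carrier G \<Longrightarrow> x \<otimes> \<rho> x \<in> P"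
  by (simp add: mem_P \<pi>_rho)

lemma conj_P: "x \<in> carrier G \<Longrightarrow> a \<in> P \<Longrightarrow> x \<otimes> a \<otimes> inv x \<in> P"
  by (simp add: mem_P)

lemma rho_one: "\<rho> \<one> = \<one>"
  using rho_mult[of \<one> \<one>] G.l_cancel_one[of "\<rho> \<one>" "\<rho> \<one>"] by simp

lemma rho_inv: "x \<in> carrier G \<Longrightarrow> \<rho> (inv x) = inv (\<rho> x)"
  using rho_mult[of x "inv x"] rho_one by (intro G.inv_equality[symmetric]) simp_all

text \<open>
  If \<open>R = P\<close>, then \<open>\<phi> (x \<otimes> \<rho> x)\<close> is the square of \<open>\<phi> x\<close> for every \<open>x\<close> in \<open>P\<close>.
\<close>

definition R where "R = {x \<in> P. \<phi> (\<rho> x) = \<phi> x}"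

lemma mem_R: "x \<in> R \<longleftrightarrow> x \<in> P \<and> \<phi> (\<rho> x) = \<phi> x"
  by (simp add: R_def)

text \<open>Products are in order since \<open>\<rho>\<close> only swaps factors that commute modulo
  \<open>D\<close>. For conjugation, \<open>\<rho>\<close> sends the conjugate of \<open>x\<close>
  by \<open>g\<close> to a conjugate congruent to \<open>?a\<close>. Now
  \<open>g \<otimes> \<rho> g\<close> lies in \<open>P\<close>, so it commutes with
  \<open>?a\<close> modulo \<open>D\<close>, and it conjugates \<open>?a\<close> into
  \<open>g \<otimes> x \<otimes> inv g\<close>.\<close>

lemma R_normal: "R \<lhd> G"
  unfolding G.normal_inv_iff
proof (intro conjI ballI)
  show "subgroup R G"
  proof
    show "R \<subseteq> carrier G" by (auto simp: R_def mem_P)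
    show "\<one> \<in> R" by (simp add: mem_R mem_P rho_one)
  next
    fix x y assume "x \<in> R" "y \<in> R"
    then show "x \<otimes> y \<in> R"
      using \<phi>_commute[of x y] by (simp add: mem_R mem_P rho_mult)
  next
    fix x assume "x \<in> R"
    then show "inv x \<in> R" by (simp add: mem_R mem_P rho_inv)
  qed
next
  fix g x assume g: "g \<in> carrier G" and x: "x \<in> R"
  then have xP: "x \<in> P" and x_eq: "\<phi> (\<rho> x) = \<phi> x" and xG: "x \<in> carrier G"
    by (auto simp: mem_R mem_P)
  let ?a = "inv (\<rho> g) \<otimes> x \<otimes> \<rho> g"
  have aP: "?a \<in> P"
    using conj_P[of "inv (\<rho> g)" x] g xP by simp
  have "\<phi> (\<rho> (g \<otimes> x \<otimes> inv g)) = \<phi> ?a"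
    using g xG by (simp add: rho_mult rho_inv x_eq G.m_assoc Q.m_assoc)
  also have "\<dots> = \<phi> ?a \<otimes>\<^bsub>G Mod D\<^esub> \<phi> (g \<otimes> \<rho> g) \<otimes>\<^bsub>G Mod D\<^esub> inv\<^bsub>G Mod D\<^esub> \<phi> (g \<otimes> \<rho> g)"
    using g xG by (simp add: Q.m_assoc)
  also have "\<dots> = \<phi> (g \<otimes> \<rho> g) \<otimes>\<^bsub>G Mod D\<^esub> \<phi> ?a \<otimes>\<^bsub>G Mod D\<^esub> inv\<^bsub>G Mod D\<^esub> \<phi> (g \<otimes> \<rho> g)"
    using \<phi>_commute[OF aP mult_rho_P[OF g]] by simp
  also have "\<dots> = \<phi> ((g \<otimes> \<rho> g) \<otimes> ?a \<otimes> inv (g \<otimes> \<rho> g))"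
    using g xG by simp
  also have "(g \<otimes> \<rho> g) \<otimes> ?a \<otimes> inv (g \<otimes> \<rho> g) = g \<otimes> x \<otimes> inv g"
    using g xG by (simp add: G.inv_mult_group G.m_assoc cancel)
  finally show "g \<otimes> x \<otimes> inv g \<in> R"
    using g xP conj_P by (simp add: mem_R)
qed

lemma odd_order_embeds:
  assumes K: "subgroup K H" "finite K" "odd (card K)" "K \<subseteq> \<pi> ` carrier G" and R: "R = P"
  obtains \<sigma> where "\<sigma> \<in> hom (H\<lparr>carrier := K\<rparr>) (G Mod D)" "inj_on \<sigma> K"
proof -
  let ?Q = "G Mod D" and ?K = "H\<lparr>carrier := K\<rparr>"
  interpret K: subgroup K H by (rule K)
  have "\<forall>g\<in>K. \<exists>x. x \<in> carrier G \<and> \<pi> x = g" using K(4) by auto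
  then obtain l where l: "\<And>g. g \<in> K \<Longrightarrow> l g \<in> carrier G" and \<pi>_l: "\<And>g. g \<in> K \<Longrightarrow> \<pi> (l g) = g"
    by metis
  define d where "d g h = l g \<otimes> l h \<otimes> inv (l (g \<otimes>\<^bsub>H\<^esub> h))" for g h
  have d: "d g h \<in> P" if "g \<in> K" "h \<in> K" for g h
    using that by (simp add: mem_P d_def l \<pi>_l K.m_closed)
  have l_mult: "l g \<otimes> l h = d g h \<otimes> l (g \<otimes>\<^bsub>H\<^esub> h)" if "g \<in> K" "h \<in> K" for g h
    using that by (simp add: d_def l G.m_assoc K.m_closed)
  \<comment> \<open>With \<open>x = l g\<close>, \<open>y = l h\<close>, \<open>z\<close> the lift
    of the product and \<open>x y = d z\<close>, both sides are the image of
    \<open>x y \<rho>(x y) = d z \<rho>(z) \<rho>(d)\<close>. The double of \<open>d\<close> appears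
    because \<open>R = P\<close> gives \<open>\<phi> (\<rho> d) = \<phi> d\<close>.\<close>
  have square: "\<phi> (l g \<otimes> \<rho> (l g)) \<otimes>\<^bsub>?Q\<^esub> (\<phi> (l g) \<otimes>\<^bsub>?Q\<^esub> \<phi> (l h \<otimes> \<rho> (l h)) \<otimes>\<^bsub>?Q\<^esub> inv\<^bsub>?Q\<^esub> \<phi> (l g))
      = \<phi> (d g h) \<otimes>\<^bsub>?Q\<^esub> \<phi> (d g h) \<otimes>\<^bsub>?Q\<^esub> \<phi> (l (g \<otimes>\<^bsub>H\<^esub> h) \<otimes> \<rho> (l (g \<otimes>\<^bsub>H\<^esub> h)))"
    if g: "g \<in> K" and h: "h \<in> K" for g h
  proof -
    let ?x = "l g" and ?y = "l h" and ?z = "l (g \<otimes>\<^bsub>H\<^esub> h)" and ?d = "d g h"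
    have cl: "?x \<in> carrier G" "?y \<in> carrier G" "?z \<in> carrier G" "?d \<in> carrier G"
      using g h l d K.m_closed mem_P by auto
    have "\<phi> (?x \<otimes> \<rho> ?x) \<otimes>\<^bsub>?Q\<^esub> (\<phi> ?x \<otimes>\<^bsub>?Q\<^esub> \<phi> (?y \<otimes> \<rho> ?y) \<otimes>\<^bsub>?Q\<^esub> inv\<^bsub>?Q\<^esub> \<phi> ?x)
      = \<phi> (?x \<otimes> \<rho> ?x) \<otimes>\<^bsub>?Q\<^esub> \<phi> (?x \<otimes> (?y \<otimes> \<rho> ?y) \<otimes> inv ?x)"
      using cl by simp
    also have "\<dots> = \<phi> (?x \<otimes> (?y \<otimes> \<rho> ?y) \<otimes> inv ?x) \<otimes>\<^bsub>?Q\<^esub> \<phi> (?x \<otimes> \<rho> ?x)"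
      using cl by (intro \<phi>_commute conj_P mult_rho_P)
    also have "\<dots> = \<phi> (?x \<otimes> (?y \<otimes> \<rho> ?y) \<otimes> inv ?x \<otimes> (?x \<otimes> \<rho> ?x))"
      using cl by (subst \<phi>.hom_mult) auto
    also have "?x \<otimes> (?y \<otimes> \<rho> ?y) \<otimes> inv ?x \<otimes> (?x \<otimes> \<rho> ?x) = (?x \<otimes> ?y) \<otimes> \<rho> (?x \<otimes> ?y)"
      using cl by (simp add: rho_mult G.m_assoc cancel)
    also have "\<dots> = ?d \<otimes> (?z \<otimes> \<rho> ?z) \<otimes> \<rho> ?d"
      unfolding l_mult[OF g h] using cl by (simp add: rho_mult G.m_assoc)
    also have "\<phi> \<dots> = \<phi> ?d \<otimes>\<^bsub>?Q\<^esub> \<phi> (?z \<otimes> \<rho> ?z) \<otimes>\<^bsub>?Q\<^esub> \<phi> (\<rho> ?d)"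
      using cl by simp
    also have "\<phi> (\<rho> ?d) = \<phi> ?d"
      using d[OF g h] R mem_R by auto
    also have "\<phi> ?d \<otimes>\<^bsub>?Q\<^esub> \<phi> (?z \<otimes> \<rho> ?z) = \<phi> (?z \<otimes> \<rho> ?z) \<otimes>\<^bsub>?Q\<^esub> \<phi> ?d"
      using cl d[OF g h] by (intro \<phi>_commute mult_rho_P)
    also have "\<phi> (?z \<otimes> \<rho> ?z) \<otimes>\<^bsub>?Q\<^esub> \<phi> ?d \<otimes>\<^bsub>?Q\<^esub> \<phi> ?d = \<phi> (?z \<otimes> \<rho> ?z) \<otimes>\<^bsub>?Q\<^esub> \<phi> (?d \<otimes> ?d)"
      using cl by (simp add: Q.m_assoc)
    also have "\<dots> = \<phi> (?d \<otimes> ?d) \<otimes>\<^bsub>?Q\<^esub> \<phi> (?z \<otimes> \<rho> ?z)"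
      using cl d[OF g h] by (intro \<phi>_commute mult_rho_P subgroup.m_closed[OF P_subgroup])
    finally show ?thesis using cl by simp
  qed
  obtain u where u: "\<And>g. g \<in> K \<Longrightarrow> u g \<in> \<phi> ` P"
    and hom: "(\<lambda>g. u g \<otimes>\<^bsub>?Q\<^esub> \<phi> (l g)) \<in> hom ?K ?Q"
  proof (rule Q.odd_order_lifts[of ?K "\<phi> ` P" "\<lambda>g. \<phi> (l g)" "\<lambda>g h. \<phi> (d g h)" "\<lambda>g. \<phi> (l g \<otimes> \<rho> (l g))"])
    show "group ?K" using K.subgroup_is_group H.is_group by simp
    show "finite (carrier ?K)" "odd (order ?K)" using K by (simp_all add: order_def)
    show "subgroup (\<phi> ` P) ?Q" by (rule \<phi>.subgroup_img_is_subgroup[OF P_subgroup])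
    show "a \<otimes>\<^bsub>?Q\<^esub> b = b \<otimes>\<^bsub>?Q\<^esub> a" if "a \<in> \<phi> ` P" "b \<in> \<phi> ` P" for a b
      using that \<phi>_commute by auto
    show "x \<otimes>\<^bsub>?Q\<^esub> a \<otimes>\<^bsub>?Q\<^esub> inv\<^bsub>?Q\<^esub> x \<in> \<phi> ` P" if x: "x \<in> carrier ?Q" and a: "a \<in> \<phi> ` P" for x a
    proof -
      obtain y where y: "y \<in> carrier G" "x = \<phi> y"
        using x by (auto simp: carrier_FactGroup \<phi>_def)
      obtain b where b: "b \<in> P" "b \<in> carrier G" "a = \<phi> b" using a mem_P by blast
      have "x \<otimes>\<^bsub>?Q\<^esub> a \<otimes>\<^bsub>?Q\<^esub> inv\<^bsub>?Q\<^esub> x = \<phi> (y \<otimes> b \<otimes> inv y)"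
        using y b by simp
      then show ?thesis using conj_P[OF y(1) b(1)] by (simp only: image_eqI)
    qed
    show "\<phi> (l g) \<otimes>\<^bsub>?Q\<^esub> \<phi> (l h) = \<phi> (d g h) \<otimes>\<^bsub>?Q\<^esub> \<phi> (l (g \<otimes>\<^bsub>?K\<^esub> h))"
      if "g \<in> carrier ?K" "h \<in> carrier ?K" for g h
      using that l_mult[of g h] d[of g h] by (simp add: l mem_P K.m_closed flip: \<phi>.hom_mult)
    show "\<phi> (l g \<otimes> \<rho> (l g)) \<in> \<phi> ` P" if "g \<in> carrier ?K" for g
      using that by (intro imageI mult_rho_P l) simp
    show "\<phi> (l g \<otimes> \<rho> (l g)) \<otimes>\<^bsub>?Q\<^esub> (\<phi> (l g) \<otimes>\<^bsub>?Q\<^esub> \<phi> (l h \<otimes> \<rho> (l h)) \<otimes>\<^bsub>?Q\<^esub> inv\<^bsub>?Q\<^esub> \<phi> (l g))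
      = \<phi> (d g h) \<otimes>\<^bsub>?Q\<^esub> \<phi> (d g h) \<otimes>\<^bsub>?Q\<^esub> \<phi> (l (g \<otimes>\<^bsub>?K\<^esub> h) \<otimes> \<rho> (l (g \<otimes>\<^bsub>?K\<^esub> h)))"
      if "g \<in> carrier ?K" "h \<in> carrier ?K" for g h
      using square[of g h] that by simp
  qed (use l d in auto)
  \<comment> \<open>The correction \<open>u\<close> takes values in the image of \<open>P\<close>,
    so \<open>\<pi>\<close> still recovers \<open>g\<close> from the corrected lift.\<close>
  have "inj_on (\<lambda>g. u g \<otimes>\<^bsub>?Q\<^esub> \<phi> (l g)) K"
  proof (rule inj_onI)
    fix g h assume g: "g \<in> K" and h: "h \<in> K" and eq: "u g \<otimes>\<^bsub>?Q\<^esub> \<phi> (l g) = u h \<otimes>\<^bsub>?Q\<^esub> \<phi> (l h)"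
    obtain a where a: "a \<in> P" "u g = \<phi> a" using u[OF g] by (rule imageE)
    obtain b where b: "b \<in> P" "u h = \<phi> b" using u[OF h] by (rule imageE)
    have cl: "a \<in> carrier G" "b \<in> carrier G" and one: "\<pi> a = \<one>\<^bsub>H\<^esub>" "\<pi> b = \<one>\<^bsub>H\<^esub>"
      using a b mem_P by auto
    have "\<phi> (a \<otimes> l g) = \<phi> (b \<otimes> l h)" using eq a b cl l[OF g] l[OF h] by simp
    then have "\<pi> (a \<otimes> l g) = \<pi> (b \<otimes> l h)"
      using cl l[OF g] l[OF h] by (intro \<pi>_eq_if_\<phi>_eq) simp_all
    then show "g = h"
      using cl one l[OF g] l[OF h] \<pi>_l[OF g] \<pi>_l[OF h] K.mem_carrier g h by simp
  qed
  with hom show thesis by (rule that)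
qed

end

section \<open>Word reversal on the braid group\<close>

text \<open>The exponents of the letters are kept; unlike inversion, reversal therefore fixes each
  generator.\<close>

definition braid_rev :: "braid_word set \<Rightarrow> braid_word set"
  where "braid_rev A = rev ` A"

abbreviation braid_class :: "nat \<Rightarrow> braid_word \<Rightarrow> braid_word set"
  where "braid_class n u \<equiv> braid_rel n `` {u}"

text \<open>Reversal preserves the defining relations: both sides of the braid relation are
  palindromes, the commutation relation has its sides swapped, and cancellation changes the sign of
  \<open>e\<close>.\<close>

lemma braid_eq_rev: "braid_eq n u v \<Longrightarrow> braid_eq n (rev u) (rev v)"
proof (induction rule: braid_eq.induct)
  case (cancel i e)
  then show ?case using braid_eq.cancel[of i n "\<not> e"] by simp
next
  case (commute i j)
  then show ?case using braid_eq.sym[OF braid_eq.commute[of i j n]] by simp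
next
  case (braid i)
  then show ?case using braid_eq.braid[of i n] by simp
qed (auto intro: braid_eq.intros)

lemma braid_rev_class: "braid_rev (braid_class n u) = braid_class n (rev u)"
proof
  show "braid_rev (braid_class n u) \<subseteq> braid_class n (rev u)"
    by (auto simp: braid_rev_def braid_rel_def intro: braid_eq_rev)
  show "braid_class n (rev u) \<subseteq> braid_rev (braid_class n u)"
  proof
    fix v assume "v \<in> braid_class n (rev u)"
    then have "rev v \<in> braid_class n u" using braid_eq_rev[of n "rev u" v] by (simp add: braid_rel_def)
    then show "v \<in> braid_rev (braid_class n u)" unfolding braid_rev_def by (metis image_eqI rev_rev_ident)
  qed
qed

lemma braid_class_closed: "u \<in> braid_words n \<Longrightarrow> braid_class n u \<in> carrier (braid_group n)"
  by (simp add: carrier_braid_group quotientI)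

lemma braid_groupE:
  assumes "A \<in> carrier (braid_group n)"
  obtains u where "u \<in> braid_words n" "A = braid_class n u"
  using assms by (auto simp: carrier_braid_group elim!: quotientE)

lemma one_braid_group: "\<one>\<^bsub>braid_group n\<^esub> = braid_class n []"
  by (simp add: braid_group_def)

text \<open>Transpositions are involutions and \<open>word_perm\<close> ignores exponents, so
  reversing a word inverts its permutation.\<close>

lemma word_perm_rev: "word_perm (rev u) \<circ> word_perm u = id"
proof (induction u)
  case (Cons x u)
  have "word_perm (rev u) (word_perm u k) = k" for k
    using Cons by (simp add: fun_eq_iff)
  then show ?case by (simp add: fun_eq_iff word_perm_append)
qed simp

section \<open>The quotient of the braid group by \<open>R\<close>\<close>

context
  fixes n :: nat
begin

interpretation B: anti_endo_extension "braid_group n" "sym_group n" braid_perm braid_rev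
proof (intro anti_endo_extension.intro anti_endo_extension_axioms.intro braid_perm_hom)
  fix x assume "x \<in> carrier (braid_group n)"
  then obtain u where u: "u \<in> braid_words n" "x = braid_class n u" by (rule braid_groupE)
  then show "braid_rev x \<in> carrier (braid_group n)"
    by (simp add: braid_rev_class braid_class_closed)
  have "word_perm (rev u) permutes {1..n}" "word_perm u permutes {1..n}"
    using u word_perm_permutes[of _ n] by simp_all
  then have "inv\<^bsub>sym_group n\<^esub> word_perm u = word_perm (rev u)"
    by (intro group.inv_equality[OF sym_group_is_group])
      (auto simp: sym_group_mult sym_group_one sym_group_carrier word_perm_rev)
  then show "braid_perm (braid_rev x) = inv\<^bsub>sym_group n\<^esub> braid_perm x"
    using u by (simp only: braid_rev_class braid_perm_class braid_words_simps)
  fix y assume "y \<in> carrier (braid_group n)"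
  then obtain v where v: "v \<in> braid_words n" "y = braid_class n v" by (rule braid_groupE)
  with u show "braid_rev (x \<otimes>\<^bsub>braid_group n\<^esub> y) = braid_rev y \<otimes>\<^bsub>braid_group n\<^esub> braid_rev x"
    by (simp add: mult_braid_group braid_rev_class)
qed

interpretation M: group "braid_group n Mod B.R"
  by (rule normal.factorgroup_is_group[OF B.R_normal])

definition braid_mod :: "braid_word \<Rightarrow> braid_word set set"
  where "braid_mod u = B.R #>\<^bsub>braid_group n\<^esub> braid_class n u"

lemma braid_mod_closed: "u \<in> braid_words n \<Longrightarrow> braid_mod u \<in> carrier (braid_group n Mod B.R)"
  by (auto simp: braid_mod_def carrier_FactGroup braid_class_closed)

lemma braid_mod_mult:
  "u \<in> braid_words n \<Longrightarrow> v \<in> braid_words n \<Longrightarrow>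
    braid_mod u \<otimes>\<^bsub>braid_group n Mod B.R\<^esub> braid_mod v = braid_mod (u @ v)"
  using hom_mult[OF normal.r_coset_hom_Mod[OF B.R_normal], of "braid_class n u" "braid_class n v"]
    braid_class_closed
  by (simp add: braid_mod_def mult_braid_group)

lemma braid_mod_Nil: "braid_mod [] = \<one>\<^bsub>braid_group n Mod B.R\<^esub>"
  using group.coset_mult_one[OF group_braid_group] normal_imp_subgroup[OF B.R_normal]
  by (simp add: braid_mod_def one_FactGroup subgroup.subset flip: one_braid_group)

lemma braid_mod_cong: "braid_eq n u v \<Longrightarrow> braid_mod u = braid_mod v"
  by (simp add: braid_mod_def braid_class_eq)

text \<open>The square of a generator is pure and a palindrome, hence fixed by reversal and an
  element of \<open>R\<close>.\<close>

lemma braid_mod_generator_square: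
  assumes "1 \<le> i" "i < n"
  shows "braid_mod [(i, True), (i, True)] = \<one>\<^bsub>braid_group n Mod B.R\<^esub>"
proof -
  let ?u = "[(i, True), (i, True)]"
  have u: "?u \<in> braid_words n" using assms by simp
  have "braid_class n ?u \<in> B.P"
    using u braid_class_closed[OF u] by (simp add: B.mem_P braid_perm_class sym_group_one)
  then have "braid_class n ?u \<in> B.R"
    by (simp add: B.mem_R braid_rev_class)
  then show ?thesis
    using group.coset_join2[OF group_braid_group braid_class_closed[OF u] normal_imp_subgroup[OF B.R_normal]]
    by (simp add: braid_mod_def one_FactGroup)
qed

interpretation coxeter_images "braid_group n Mod B.R" n "\<lambda>i. braid_mod [(i, True)]"
proof
  fix i j :: nat
  show "braid_mod [(i, True)] \<in> carrier (braid_group n Mod B.R)" if "1 \<le> i" "i < n"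
    using that by (intro braid_mod_closed) simp
  show "braid_mod [(i, True)] \<otimes>\<^bsub>braid_group n Mod B.R\<^esub> braid_mod [(i, True)] = \<one>\<^bsub>braid_group n Mod B.R\<^esub>"
    if "1 \<le> i" "i < n"
    using that braid_mod_generator_square by (simp add: braid_mod_mult)
  show "braid_mod [(i, True)] \<otimes>\<^bsub>braid_group n Mod B.R\<^esub> braid_mod [(j, True)]
      = braid_mod [(j, True)] \<otimes>\<^bsub>braid_group n Mod B.R\<^esub> braid_mod [(i, True)]"
    if "1 \<le> i" "i + 2 \<le> j" "j < n"
    using that braid_mod_cong[OF braid_eq.commute[OF that]] by (simp add: braid_mod_mult)
  show "braid_mod [(i, True)] \<otimes>\<^bsub>braid_group n Mod B.R\<^esub>
        (braid_mod [(i + 1, True)] \<otimes>\<^bsub>braid_group n Mod B.R\<^esub> braid_mod [(i, True)])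
      = braid_mod [(i + 1, True)] \<otimes>\<^bsub>braid_group n Mod B.R\<^esub>
        (braid_mod [(i, True)] \<otimes>\<^bsub>braid_group n Mod B.R\<^esub> braid_mod [(i + 1, True)])"
    if "1 \<le> i" "i + 1 < n"
    using that braid_mod_cong[OF braid_eq.braid[OF that]] by (simp add: braid_mod_mult)
qed

lemma braid_mod_ev: "u \<in> braid_words n \<Longrightarrow> braid_mod u = ev (map fst u)"
proof (induction u)
  case (Cons x u)
  obtain i e where x: "x = (i, e)" by force
  have i: "1 \<le> i" "i < n" and u: "u \<in> braid_words n" using Cons.prems by (auto simp: x)
  have "braid_mod [(i, False)] = braid_mod [(i, True)]"
  proof -
    have "braid_mod [(i, False)] \<otimes>\<^bsub>braid_group n Mod B.R\<^esub> braid_mod [(i, True)] = \<one>\<^bsub>braid_group n Mod B.R\<^esub>"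
      using i braid_mod_cong[OF braid_eq.cancel[of i n False]] by (simp add: braid_mod_mult braid_mod_Nil)
    then have "braid_mod [(i, False)] = inv\<^bsub>braid_group n Mod B.R\<^esub> braid_mod [(i, True)]"
      using i by (intro M.inv_equality[symmetric] braid_mod_closed) simp_all
    also have "\<dots> = braid_mod [(i, True)]"
      using i s_square by (intro M.inv_equality braid_mod_closed) simp_all
    finally show ?thesis .
  qed
  then have "braid_mod [x] = braid_mod [(i, True)]" by (cases e) (simp_all add: x)
  then show ?case
    using Cons.IH[OF u] braid_mod_mult[of "[x]" u] i u by (simp add: x)
qed (simp add: braid_mod_Nil)

text \<open>A pure braid is represented by a word with trivial permutation. The quotient by
  \<open>R\<close> satisfies the Coxeter relations, so \<open>ev_eq_one\<close> makes this word
  trivial there, that is, puts the braid into \<open>R\<close>.\<close>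

lemma braid_R_eq_P: "B.R = B.P"
proof
  show "B.R \<subseteq> B.P" by (auto simp: B.mem_R)
  show "B.P \<subseteq> B.R"
  proof
    fix A assume A: "A \<in> B.P"
    then obtain u where u: "u \<in> braid_words n" "A = braid_class n u"
      using B.mem_P braid_groupE by metis
    \<comment> \<open>Elements of \<open>R\<close> have trivial permutation, so
      \<open>braid_perm\<close> factors through the quotient by \<open>R\<close>.\<close>
    obtain \<pi> where \<pi>: "\<pi> \<in> hom (braid_group n Mod B.R) (sym_group n)"
      and \<pi>_eq: "\<And>x. x \<in> carrier (braid_group n) \<Longrightarrow> \<pi> (B.R #>\<^bsub>braid_group n\<^esub> x) = braid_perm x"
    proof (rule FactGroup_universal[OF B.homh B.R_normal])
      show "braid_perm x = braid_perm y"
        if "x \<in> carrier (braid_group n)" "y \<in> carrier (braid_group n)"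
          "B.R #>\<^bsub>braid_group n\<^esub> x = B.R #>\<^bsub>braid_group n\<^esub> y" for x y
      proof -
        have "x \<in> B.R #>\<^bsub>braid_group n\<^esub> y"
          using group.rcos_self[OF group_braid_group that(1) normal_imp_subgroup[OF B.R_normal]] that(3) by simp
        then obtain r where "r \<in> B.R" "x = r \<otimes>\<^bsub>braid_group n\<^esub> y" by (auto simp: r_coset_def)
        then show ?thesis using that by (simp add: B.mem_R B.mem_P)
      qed
    qed auto
    have "\<pi> (braid_mod u) = id"
      using A u \<pi>_eq by (simp add: braid_mod_def braid_class_closed B.mem_P sym_group_one)
    then have "\<pi> (ev (map fst u)) = id" using braid_mod_ev[OF u(1)] by simp
    moreover have "set (map fst u) \<subseteq> {1..<n}"
      using u(1) by (auto simp: braid_words_def)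
    moreover have "\<pi> (braid_mod [(i, True)]) = transpose i (Suc i)" if "1 \<le> i" "i < n" for i
      using that \<pi>_eq by (simp add: braid_mod_def braid_class_closed braid_perm_class)
    ultimately have "ev (map fst u) = \<one>\<^bsub>braid_group n Mod B.R\<^esub>"
      by (intro ev_eq_one[OF \<pi>, of "map fst u" n]) simp_all
    then have "B.R #>\<^bsub>braid_group n\<^esub> A = B.R"
      using braid_mod_ev[OF u(1)] u by (simp add: braid_mod_def one_FactGroup)
    then show "A \<in> B.R"
      using group.rcos_self[OF group_braid_group _ normal_imp_subgroup[OF B.R_normal], of A] u
      by (simp add: braid_class_closed)
  qed
qed

section \<open>Surjectivity onto the symmetric group and the embedding of its subgroups of odd
  order\<close>

lemma transpose_adjacent_in_image:
  "1 \<le> i \<Longrightarrow> i < n \<Longrightarrow> transpose i (Suc i) \<in> braid_perm ` carrier (braid_group n)"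
  using braid_class_closed[of "[(i, True)]" n] braid_perm_class[of "[(i, True)]" n]
  by (force simp: image_iff)

lemma braid_perm_surj: "braid_perm ` carrier (braid_group n) = carrier (sym_group n)"
proof
  let ?I = "braid_perm ` carrier (braid_group n)"
  show "?I \<subseteq> carrier (sym_group n)" by auto
  have I: "subgroup ?I (sym_group n)" by (rule B.img_is_subgroup)
  have comp: "f \<circ> g \<in> ?I" if "f \<in> ?I" "g \<in> ?I" for f g
    using subgroup.m_closed[OF I that] by (simp add: sym_group_mult)
  have transp: "transpose i j \<in> ?I" if "1 \<le> i" "i < j" "j \<le> n" for i j
    using that(2,3)
  proof (induction j)
    case (Suc j)
    show ?case
    proof (cases "i = j")
      case True
      then show ?thesis using that(1) Suc.prems transpose_adjacent_in_image by simp
    next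
      case False
      then have "transpose i j \<in> ?I" "transpose j (Suc j) \<in> ?I"
        using that(1) Suc transpose_adjacent_in_image[of j] by auto
      \<comment> \<open>Conjugating by an adjacent transposition raises the upper index by
        one.\<close>
      then have "transpose j (Suc j) \<circ> transpose i j \<circ> transpose j (Suc j) \<in> ?I"
        by (intro comp)
      also have "transpose j (Suc j) \<circ> transpose i j \<circ> transpose j (Suc j) = transpose i (Suc j)"
        using transpose_comp_triple[of "Suc j" i j] Suc.prems False by (simp add: transpose_commute)
      finally show ?thesis .
    qed
  qed simp
  show "carrier (sym_group n) \<subseteq> ?I"
  proof
    fix f assume "f \<in> carrier (sym_group n)"
    then have "f permutes {1..n}" "finite {1..n}" by (simp_all add: sym_group_carrier)
    then show "f \<in> ?I"
    proof (induction rule: permutes_induct)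
      case id
      then show ?case using subgroup.one_closed[OF I] by (simp only: sym_group_one)
    next
      case (swap a b f)
      then have "transpose a b \<in> ?I"
        using transp[of a b] transp[of b a] by (cases "a < b") (auto simp: transpose_commute)
      with swap show ?case by (intro comp)
    qed
  qed
qed

theorem odd_order_subgroup_embeds:
  assumes "subgroup K (sym_group n)" "odd (card K)"
  obtains \<sigma> where "\<sigma> \<in> hom (sym_group n\<lparr>carrier := K\<rparr>)
      (braid_group n Mod derived (braid_group n) (pure_braid_group n))" "inj_on \<sigma> K"
proof -
  \<comment> \<open>An infinite set has cardinality \<open>0\<close>, which is even.\<close>
  have "finite K" using assms(2) by (metis card.infinite even_zero)
  then show ?thesis
    using B.odd_order_embeds[OF assms(1) _ assms(2) _ braid_R_eq_P] that
      subgroup.subset[OF assms(1)] unfolding braid_perm_surj B.D_def B.P_def pure_braid_group_def by blast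
qed

end

section \<open>Affine maps with square slope\<close>

text \<open>
  Residues modulo \<open>p\<close> are represented in \<open>{1..p}\<close>, the set on which \<open>sym_group p\<close> acts; the
  slope of \<open>square_affine p c b\<close> is \<open>c\<^sup>2\<close>.
\<close>

definition res_rep :: "nat \<Rightarrow> int \<Rightarrow> nat"
  where "res_rep p y = Suc (nat ((y - 1) mod int p))"

definition square_affine :: "nat \<Rightarrow> int \<Rightarrow> int \<Rightarrow> nat \<Rightarrow> nat"
  where "square_affine p c b x = (if x \<in> {1..p} then res_rep p (c\<^sup>2 * int x + b) else x)"

text \<open>The parameter is a root \<open>c\<close> of the slope, which makes closure under
  composition immediate; \<open>c\<close> and \<open>- c\<close> give the same map.\<close>

definition square_affine_group :: "nat \<Rightarrow> (nat \<Rightarrow> nat) set"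
  where "square_affine_group p = {square_affine p c b |c b. \<not> int p dvd c}"

lemma res_rep_mem: "p > 0 \<Longrightarrow> res_rep p y \<in> {1..p}"
  using pos_mod_bound[of "int p" "y - 1"] by (simp add: res_rep_def nat_less_iff Suc_le_eq)

lemma res_rep_cong: "p > 0 \<Longrightarrow> [int (res_rep p y) = y] (mod int p)"
proof -
  assume "p > 0"
  then have "int (res_rep p y) = (y - 1) mod int p + 1" by (simp add: res_rep_def)
  then show ?thesis by (simp add: cong_def mod_simps)
qed

lemma square_affine_outside: "x \<notin> {1..p} \<Longrightarrow> square_affine p c b x = x"
  unfolding square_affine_def by (rule if_not_P)

lemma residue_unique:
  assumes "x \<in> {1..p}" "y \<in> {1..p}" "[int x = int y] (mod int p)"
  shows "x = y"
proof -
  have "int p dvd int x - int y" using assms(3) by (simp add: cong_iff_dvd_diff)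
  moreover have "\<bar>int x - int y\<bar> < int p" using assms(1,2) by auto
  ultimately show ?thesis using dvd_imp_le_int[of "int x - int y" "int p"] by auto
qed

context
  fixes p :: nat
  assumes prime: "Factorial_Ring.prime p"
begin

lemma p_pos: "p > 0"
  using prime prime_gt_0_nat by blast

lemma dvd_mult_iff: "int p dvd a * b \<longleftrightarrow> int p dvd a \<or> int p dvd b"
  using prime by (simp add: prime_dvd_mult_iff)

lemma square_affine_mem: "x \<in> {1..p} \<Longrightarrow> square_affine p c b x \<in> {1..p}"
  using res_rep_mem[OF p_pos] by (simp add: square_affine_def del: atLeastAtMost_iff)

lemma square_affine_cong:
  "x \<in> {1..p} \<Longrightarrow> [int (square_affine p c b x) = c\<^sup>2 * int x + b] (mod int p)"
  using res_rep_cong[OF p_pos] by (simp add: square_affine_def del: atLeastAtMost_iff)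

lemma square_affine_eqI:
  assumes "x \<in> {1..p}" "y \<in> {1..p}" "[c\<^sup>2 * int x + b = int y] (mod int p)"
  shows "square_affine p c b x = y"
  using residue_unique[OF square_affine_mem[OF assms(1)] assms(2)]
    cong_trans[OF square_affine_cong[OF assms(1)] assms(3)] by blast

lemma square_affine_comp:
  "square_affine p c b \<circ> square_affine p d e = square_affine p (c * d) (c\<^sup>2 * e + b)"
proof
  fix x
  show "(square_affine p c b \<circ> square_affine p d e) x = square_affine p (c * d) (c\<^sup>2 * e + b) x"
  proof (cases "x \<in> {1..p}")
    case True
    let ?y = "square_affine p d e x"
    have 1: "[c\<^sup>2 * int ?y + b = c\<^sup>2 * (d\<^sup>2 * int x + e) + b] (mod int p)"
      using square_affine_cong[OF True] by (intro cong_add cong_scalar_left cong_refl)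
    have 2: "c\<^sup>2 * (d\<^sup>2 * int x + e) + b = (c * d)\<^sup>2 * int x + (c\<^sup>2 * e + b)"
      by (simp add: algebra_simps power_mult_distrib)
    note cong_trans[OF 1[unfolded 2] cong_sym[OF square_affine_cong[OF True]]]
    then show ?thesis
      using square_affine_eqI[OF square_affine_mem[OF True] square_affine_mem[OF True]] by simp
  next
    case False
    then show ?thesis by (simp only: comp_apply square_affine_outside not_False_eq_True)
  qed
qed

lemma square_affine_eq:
  assumes "[c\<^sup>2 = d\<^sup>2] (mod int p)" "[b = e] (mod int p)"
  shows "square_affine p c b = square_affine p d e"
proof
  fix x
  show "square_affine p c b x = square_affine p d e x"
  proof (cases "x \<in> {1..p}")
    case True
    have "[c\<^sup>2 * int x + b = d\<^sup>2 * int x + e] (mod int p)"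
      using assms by (intro cong_add cong_scalar_right)
    from cong_trans[OF this cong_sym[OF square_affine_cong[OF True]]]
    show ?thesis by (rule square_affine_eqI[OF True square_affine_mem[OF True]])
  next
    case False
    then show ?thesis by (simp only: square_affine_outside not_False_eq_True)
  qed
qed

lemma square_affine_1_0: "square_affine p 1 0 = id"
proof
  fix x show "square_affine p 1 0 x = id x"
    using square_affine_eqI[of x x 1 0] square_affine_outside[of x p 1 0]
    by (cases "x \<in> {1..p}") simp_all
qed

lemma square_affine_inverse:
  assumes "\<not> int p dvd c"
  obtains d e where "\<not> int p dvd d" "square_affine p c b \<circ> square_affine p d e = id"
    "square_affine p d e \<circ> square_affine p c b = id"
proof -
  have "Factorial_Ring.prime (int p)" using prime by simp
  then have "coprime (int p) c" using assms prime_imp_coprime by blast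
  then obtain d where d: "[c * d = 1] (mod int p)"
    using cong_solve_coprime_int[of c "int p"] by (auto simp: coprime_commute)
  have "\<not> int p dvd d"
  proof
    assume "int p dvd d"
    then have "[c * d = 0] (mod int p)" by (simp add: cong_0_iff)
    with d have "[1 = 0] (mod int p)" by (meson cong_sym cong_trans)
    then show False using prime by (simp add: cong_0_iff)
  qed
  moreover have d2: "[(c * d)\<^sup>2 = 1\<^sup>2] (mod int p)" using d by (rule cong_pow)
  \<comment> \<open>With \<open>d\<close> inverse to \<open>c\<close>, the inverse of
    \<open>x \<mapsto> c\<^sup>2 x + b\<close> is
    \<open>x \<mapsto> d\<^sup>2 x - d\<^sup>2 b\<close>.\<close>
  have "[c\<^sup>2 * (- (d\<^sup>2 * b)) + b = - (1 * b) + b] (mod int p)"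
  proof -
    have "[- ((c * d)\<^sup>2 * b) + b = - (1\<^sup>2 * b) + b] (mod int p)"
      using cong_scalar_right[OF d2, of b] by (intro cong_add cong_refl) (simp only: cong_minus_minus_iff)
    then show ?thesis by (simp add: power_mult_distrib mult.assoc)
  qed
  then have "square_affine p c b \<circ> square_affine p d (- (d\<^sup>2 * b)) = id"
    unfolding square_affine_comp square_affine_1_0[symmetric] using d2 by (intro square_affine_eq) simp_all
  moreover have "square_affine p d (- (d\<^sup>2 * b)) \<circ> square_affine p c b = id"
    unfolding square_affine_comp square_affine_1_0[symmetric] using d2 by (intro square_affine_eq) (simp_all add: mult.commute)
  ultimately show thesis by (rule that)
qed

lemma square_affine_permutes:
  assumes "\<not> int p dvd c"
  shows "square_affine p c b permutes {1..p}"
proof -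
  obtain d e where "square_affine p c b \<circ> square_affine p d e = id"
    "square_affine p d e \<circ> square_affine p c b = id"
    using square_affine_inverse[OF assms] by metis
  then have "bij (square_affine p c b)" by (metis o_bij)
  moreover have "square_affine p c b x = x" if "x \<notin> {1..p}" for x
    using that by (rule square_affine_outside)
  ultimately show ?thesis unfolding permutes_def bij_iff by blast
qed

lemma square_affine_group_subgroup: "subgroup (square_affine_group p) (sym_group p)"
proof (rule group.subgroupI[OF sym_group_is_group])
  show "square_affine_group p \<subseteq> carrier (sym_group p)"
    using square_affine_permutes by (auto simp: square_affine_group_def sym_group_carrier)
  have "\<not> int p dvd 1" using prime not_prime_1 by fastforce
  then show "square_affine_group p \<noteq> {}" unfolding square_affine_group_def by blast
next
  fix f assume "f \<in> square_affine_group p"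
  then obtain c b where f: "f = square_affine p c b" "\<not> int p dvd c"
    by (auto simp: square_affine_group_def)
  obtain d e where de: "\<not> int p dvd d" "square_affine p c b \<circ> square_affine p d e = id"
    "square_affine p d e \<circ> square_affine p c b = id"
    using square_affine_inverse[OF f(2)] by metis
  then have "inv\<^bsub>sym_group p\<^esub> f = square_affine p d e"
    using f square_affine_permutes
    by (intro group.inv_equality[OF sym_group_is_group])
      (simp_all add: sym_group_mult sym_group_one sym_group_carrier)
  then show "inv\<^bsub>sym_group p\<^esub> f \<in> square_affine_group p"
    using de(1) by (auto simp: square_affine_group_def)
next
  fix f g assume "f \<in> square_affine_group p" "g \<in> square_affine_group p"
  then obtain c b d e where "f = square_affine p c b" "\<not> int p dvd c" "g = square_affine p d e" "\<not> int p dvd d"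
    by (auto simp: square_affine_group_def)
  moreover from this have "\<not> int p dvd c * d" by (simp add: dvd_mult_iff)
  ultimately show "f \<otimes>\<^bsub>sym_group p\<^esub> g \<in> square_affine_group p"
    unfolding square_affine_group_def sym_group_mult by (auto simp: square_affine_comp)
qed

text \<open>Two roots give the same slope exactly when they agree up to sign modulo
  \<open>p\<close>, so \<open>{1..h}\<close> parametrises the slopes, and \<open>{0..<p}\<close> the
  translations.\<close>

lemma card_square_affine_group:
  assumes p: "p = 2 * h + 1"
  shows "card (square_affine_group p) = h * p"
proof -
  let ?I = "{1..h} \<times> {0..<p}"
  let ?f = "\<lambda>(c, b). square_affine p (int c) (int b)"
  have small: "\<not> int p dvd k" if "0 < k" "k < int p" for k
    using that zdvd_not_zless by blast
  have "inj_on ?f ?I"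
  proof (rule inj_onI; clarify)
    fix c b d e assume cb: "c \<in> {1..h}" "b \<in> {0..<p}" "d \<in> {1..h}" "e \<in> {0..<p}"
      and eq: "square_affine p (int c) (int b) = square_affine p (int d) (int e)"
    have eq_cong: "[(int c)\<^sup>2 * int x + int b = (int d)\<^sup>2 * int x + int e] (mod int p)" if "x \<in> {1..p}" for x
      using square_affine_cong[OF that, of "int c" "int b"] square_affine_cong[OF that, of "int d" "int e"]
      unfolding eq by (meson cong_sym cong_trans)
    \<comment> \<open>The point \<open>p\<close> represents zero, so evaluation there isolates the
      translation; evaluation at \<open>1\<close> then gives the slope.\<close>
    have "[int b = int e] (mod int p)"
      using eq_cong[of p] p_pos by (simp add: cong_def)
    then have be: "b = e" using cb by (simp add: cong_int_iff cong_less_modulus_unique_nat)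
    have "[(int c)\<^sup>2 = (int d)\<^sup>2] (mod int p)"
      using eq_cong[of 1] p_pos be by (simp add: cong_add_rcancel)
    then have "int p dvd (int c - int d) * (int c + int d)"
      by (simp add: cong_iff_dvd_diff power2_eq_square algebra_simps)
    \<comment> \<open>The sum lies between \<open>2\<close> and \<open>2 * h\<close>, hence strictly
      between \<open>0\<close> and \<open>p\<close>.\<close>
    moreover have "\<not> int p dvd int c + int d"
      using cb p by (intro small) auto
    ultimately have "[int c = int d] (mod int p)"
      by (simp add: dvd_mult_iff cong_iff_dvd_diff)
    then have "c = d" using cb p by (intro residue_unique[of c p d]) auto
    with be show "c = d \<and> b = e" by simp
  qed
  moreover have "?f ` ?I = square_affine_group p"
  proof
    show "?f ` ?I \<subseteq> square_affine_group p"
    proof clarify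
      fix c b assume "c \<in> {1..h}"
      then have "\<not> int p dvd int c" using p by (intro small) auto
      then show "square_affine p (int c) (int b) \<in> square_affine_group p"
        by (auto simp: square_affine_group_def)
    qed
    show "square_affine_group p \<subseteq> ?f ` ?I"
    proof
      fix f assume "f \<in> square_affine_group p"
      then obtain c b where f: "f = square_affine p c b" and c: "\<not> int p dvd c"
        by (auto simp: square_affine_group_def)
      define r where "r = c mod int p"
      \<comment> \<open>This is the absolute value of the residue of \<open>c\<close> that is least
        in absolute value; it has the same square as \<open>c\<close> modulo
        \<open>p\<close>.\<close>
      define c' where "c' = (if r \<le> int h then nat r else nat (int p - r))"
      have "r \<noteq> 0" "0 \<le> r" "r < int p"
        using c p_pos by (auto simp: r_def)
      then have r: "0 < r" "r < int p" by simp_all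
      have "c' \<in> {1..h}" using r p by (auto simp: c'_def)
      moreover have "[c\<^sup>2 = (int c')\<^sup>2] (mod int p)"
      proof -
        have cr: "[c = r] (mod int p)" by (simp add: r_def cong_def)
        have "[r\<^sup>2 = (int p - r)\<^sup>2] (mod int p)"
          by (simp add: cong_iff_dvd_diff power2_eq_square algebra_simps)
        then have "[r\<^sup>2 = (int c')\<^sup>2] (mod int p)" using r by (simp add: c'_def)
        with cong_pow[OF cr, of 2] show ?thesis by (rule cong_trans)
      qed
      moreover have "[b = int (nat (b mod int p))] (mod int p)" using p_pos by (simp add: cong_def)
      moreover have "nat (b mod int p) \<in> {0..<p}" using p_pos by (simp add: nat_less_iff)
      ultimately show "f \<in> ?f ` ?I"
        unfolding f by (intro image_eqI[of _ _ "(c', nat (b mod int p))"]) (auto intro: square_affine_eq)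
    qed
  qed
  ultimately have "card (square_affine_group p) = card ?I" by (metis card_image)
  then show ?thesis by simp
qed

text \<open>A map of slope one is a translation, and only the trivial one has a fixed point. For
  \<open>p = 3\<close> every slope is one, so this also gives the degenerate case.\<close>

lemma square_affine_fixed_point:
  assumes "x \<in> {1..p}" "square_affine p c b x = x" "[c\<^sup>2 = 1] (mod int p)"
  shows "square_affine p c b = id"
proof -
  have "[int x + 0 = c\<^sup>2 * int x + b] (mod int p)"
    using square_affine_cong[OF assms(1), of c b] assms(2) by simp
  moreover have "[c\<^sup>2 * int x + b = 1 * int x + b] (mod int p)"
    using assms(3) by (intro cong_add cong_scalar_right cong_refl)
  ultimately have "[int x + 0 = 1 * int x + b] (mod int p)" by (rule cong_trans)
  then have "[0 = b] (mod int p)" by (simp only: mult_1 cong_add_lcancel)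
  then show ?thesis
    unfolding square_affine_1_0[symmetric] using assms(3)
    by (intro square_affine_eq) (simp_all add: cong_sym_eq)
qed

text \<open>Subtracting the two fixed point equations gives
  \<open>(1 - c\<^sup>2) (x - y) = 0\<close> modulo \<open>p\<close>. Distinct points of
  \<open>{1..p}\<close> are incongruent, so the slope is one.\<close>

lemma square_affine_two_fixed_points:
  assumes "x \<in> {1..p}" "y \<in> {1..p}" "x \<noteq> y"
    and "square_affine p c b x = x" "square_affine p c b y = y"
  shows "square_affine p c b = id"
proof (rule square_affine_fixed_point[OF assms(1,4)])
  have "[int x - int y = (c\<^sup>2 * int x + b) - (c\<^sup>2 * int y + b)] (mod int p)"
    using square_affine_cong[OF assms(1), of c b] square_affine_cong[OF assms(2), of c b] assms(4,5)
    by (intro cong_diff) simp_all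
  then have "int p dvd (1 - c\<^sup>2) * (int x - int y)"
    by (simp add: cong_iff_dvd_diff algebra_simps)
  moreover have "\<not> int p dvd int x - int y"
    using residue_unique[OF assms(1,2)] assms(3) by (auto simp: cong_iff_dvd_diff)
  ultimately show "[c\<^sup>2 = 1] (mod int p)"
    by (simp add: dvd_mult_iff cong_iff_dvd_diff dvd_diff_commute)
qed

lemma square_affine_transitive:
  assumes "x \<in> {1..p}" "y \<in> {1..p}"
  shows "square_affine p 1 (int y - int x) x = y"
  using assms by (intro square_affine_eqI) simp_all

end

section \<open>Transport of a permutation action along an injective homomorphism\<close>

locale perm_group_image =
  fixes n :: nat and K :: "(nat \<Rightarrow> nat) set" and Q :: "('a, 'b) monoid_scheme" and \<sigma>
  assumes subgroup_K: "subgroup K (sym_group n)" and group_Q: "group Q"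
    and \<sigma>_hom: "\<sigma> \<in> hom (sym_group n\<lparr>carrier := K\<rparr>) Q" and inj: "inj_on \<sigma> K"
begin

abbreviation image_group where "image_group \<equiv> Q\<lparr>carrier := \<sigma> ` K\<rparr>"

text \<open>The restriction is there because elements of \<open>BijGroup {1..n}\<close> are
  extensional functions, whereas permutations in \<open>sym_group n\<close> are the identity outside
  \<open>{1..n}\<close>.\<close>

definition act :: "'a \<Rightarrow> nat \<Rightarrow> nat"
  where "act q = restrict (inv_into K \<sigma> q) {1..n}"

sublocale \<sigma>: group_hom "sym_group n\<lparr>carrier := K\<rparr>" Q \<sigma>
  using subgroup.subgroup_is_group[OF subgroup_K sym_group_is_group] group_Q \<sigma>_hom
  by (intro group_hom.intro group_hom_axioms.intro)

lemma subgroup_image: "subgroup (\<sigma> ` K) Q"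
  using \<sigma>.img_is_subgroup by simp

lemma order_image: "order image_group = card K"
  by (simp add: order_def card_image[OF inj])

lemma one_image: "\<one>\<^bsub>image_group\<^esub> = \<sigma> id"
  using \<sigma>.hom_one by (simp add: sym_group_one)

lemma act_\<sigma>: "f \<in> K \<Longrightarrow> act (\<sigma> f) = restrict f {1..n}"
  by (simp add: act_def inv_into_f_f[OF inj])

lemma permutes: "f \<in> K \<Longrightarrow> f permutes {1..n}"
  using subgroup.subset[OF subgroup_K] sym_group_carrier by blast

lemma faithful_action: "faithful_action image_group {1..n} act"
proof (intro faithful_action.intro group_action.intro faithful_action_axioms.intro
    group_hom.intro group_hom_axioms.intro)
  show "group image_group" by (rule subgroup.subgroup_is_group[OF subgroup_image group_Q])
  show "group (BijGroup {1..n})" by (rule group_BijGroup)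
  have Bij: "restrict f {1..n} \<in> Bij {1..n}" if "f \<in> K" for f
    using permutes_imp_bij[OF permutes[OF that]] bij_betw_cong[of "{1..n}" "restrict f {1..n}" f]
    by (simp add: Bij_def)
  show "act \<in> hom image_group (BijGroup {1..n})"
  proof (rule homI)
    fix x assume "x \<in> carrier image_group"
    then obtain f where f: "f \<in> K" "x = \<sigma> f" by auto
    then show "act x \<in> carrier (BijGroup {1..n})" using Bij by (simp add: act_\<sigma> BijGroup_def)
    fix y assume "y \<in> carrier image_group"
    then obtain g where g: "g \<in> K" "y = \<sigma> g" by auto
    have "\<sigma> f \<otimes>\<^bsub>Q\<^esub> \<sigma> g = \<sigma> (f \<circ> g)"
      using \<sigma>.hom_mult[of f g] f g by (simp add: sym_group_mult)
    moreover have "f \<circ> g \<in> K"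
      using subgroup.m_closed[OF subgroup_K f(1) g(1)] by (simp add: sym_group_mult)
    moreover have "restrict (f \<circ> g) {1..n} = compose {1..n} (restrict f {1..n}) (restrict g {1..n})"
      using permutes_in_image[OF permutes[OF g(1)]] by (auto simp: compose_def fun_eq_iff)
    ultimately show "act (x \<otimes>\<^bsub>image_group\<^esub> y) = act x \<otimes>\<^bsub>BijGroup {1..n}\<^esub> act y"
      using f g Bij by (simp add: act_\<sigma> BijGroup_def)
  qed
  show "inj_on act (carrier image_group)"
  proof (rule inj_onI)
    fix x y assume "x \<in> carrier image_group" "y \<in> carrier image_group" and eq: "act x = act y"
    then obtain f g where f: "f \<in> K" "x = \<sigma> f" and g: "g \<in> K" "y = \<sigma> g" by auto
    have "f k = g k" for k
    proof (cases "k \<in> {1..n}")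
      case True
      then show ?thesis using eq f g by (metis act_\<sigma> restrict_apply')
    next
      case False
      then show ?thesis using f g permutes permutes_not_in by metis
    qed
    then have "f = g" by (rule ext)
    then show "x = y" using f g by simp
  qed
qed

lemma transitive_action:
  assumes "\<And>x y. x \<in> {1..n} \<Longrightarrow> y \<in> {1..n} \<Longrightarrow> \<exists>f\<in>K. f x = y"
  shows "transitive_action image_group {1..n} act"
proof (intro transitive_action.intro transitive_action_axioms.intro)
  show "group_action image_group {1..n} act"
    using faithful_action by (rule faithful_action.axioms)
  fix x y assume x: "x \<in> {1..n}" and "y \<in> {1..n}"
  then obtain f where "f \<in> K" "f x = y" using assms by blast
  then show "\<exists>g\<in>carrier image_group. act g x = y"
    using x by (intro bexI[of _ "\<sigma> f"]) (simp_all add: act_\<sigma>)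
qed

end

section \<open>The Frobenius subgroup of order \<open>p (p - 1) / 2\<close>\<close>

theorem corollary3p11:
  fixes p :: nat
  assumes "Factorial_Ring.prime p" and "p mod 4 = 3"
  defines "Q \<equiv> braid_group p Mod derived (braid_group p) (pure_braid_group p)"
  shows "\<exists>H. subgroup H Q \<and>
    order (Q\<lparr>carrier := H\<rparr>) = p * (p - 1) div 2 \<and>
    (frobenius_group (Q\<lparr>carrier := H\<rparr>) \<or>
      p = 3 \<and> degenerate_frobenius_group (Q\<lparr>carrier := H\<rparr>)) \<and>
    (p > 3 \<longrightarrow> \<not> comm_group (Q\<lparr>carrier := H\<rparr>))"
proof -
  let ?K = "square_affine_group p"
  note prime = assms(1)
  define h where "h = (p - 1) div 2"
  \<comment> \<open>The congruence modulo 4 makes \<open>h\<close> odd, and with it the order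
    \<open>h * p\<close>, as the embedding requires.\<close>
  have p: "p = 2 * h + 1" and "odd h" using assms(2) unfolding h_def by presburger+
  have card: "card ?K = h * p" by (rule card_square_affine_group[OF prime p])
  have "odd (card ?K)" unfolding card using p \<open>odd h\<close> by simp
  then obtain \<sigma> where \<sigma>: "\<sigma> \<in> hom (sym_group p\<lparr>carrier := ?K\<rparr>) Q" and inj: "inj_on \<sigma> ?K"
    using odd_order_subgroup_embeds[OF square_affine_group_subgroup[OF prime]] unfolding Q_def by metis
  have "group Q"
    unfolding Q_def by (rule normal.factorgroup_is_group[OF derived_pure_braid_group_normal])
  then interpret perm_group_image p ?K Q \<sigma>
    using square_affine_group_subgroup[OF prime] \<sigma> inj by (intro perm_group_image.intro)
  let ?H = "\<sigma> ` ?K"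
  have order: "order image_group = p * (p - 1) div 2"
    unfolding order_image card using p by simp
  have one_unit: "\<not> int p dvd 1"
    using prime not_prime_1 by fastforce
  have p_mem: "p \<in> {1..p}" "1 \<in> {1..p}" using p by simp_all
  have transitive: "transitive_action image_group {1..p} act"
  proof (rule transitive_action)
    fix x y assume "x \<in> {1..p}" "y \<in> {1..p}"
    from square_affine_transitive[OF prime this] one_unit show "\<exists>f\<in>?K. f x = y"
      unfolding square_affine_group_def by blast
  qed
  have fixed: "act (\<sigma> f) x = x \<longleftrightarrow> f x = x" if "f \<in> ?K" "x \<in> {1..p}" for f x
    using that by (simp add: act_\<sigma>)
  have frob: "frobenius_group image_group \<and> \<not> comm_group image_group" if "p > 3"
  proof
    \<comment> \<open>The map \<open>x \<mapsto> 4 x\<close> fixes \<open>p\<close>, which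
      represents zero, but moves \<open>1\<close> to \<open>4\<close>, so it is a nontrivial element
      of a point stabilizer. It does not commute with \<open>x \<mapsto> x + 1\<close>: the two
      composites send \<open>p\<close> to \<open>4\<close> and to \<open>1\<close>.\<close>
    let ?f = "square_affine p 2 0" and ?g = "square_affine p 1 1"
    have p_ge: "p \<ge> 7" using that assms(2) by presburger
    then have "\<not> int p dvd 2" "\<not> int p dvd 3" by (auto dest: zdvd_imp_le)
    then have fg: "?f \<in> ?K" "?g \<in> ?K"
      using one_unit unfolding square_affine_group_def by blast+
    have f1: "?f 1 = 4" and fp: "?f p = p" and gp: "?g p = 1"
      using p_ge by (auto intro!: square_affine_eqI[OF prime] simp: cong_def)
    have f_ne: "\<sigma> ?f \<noteq> \<one>\<^bsub>image_group\<^esub>"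
    proof
      assume "\<sigma> ?f = \<one>\<^bsub>image_group\<^esub>"
      then have "act (\<sigma> ?f) 1 = act (\<sigma> id) 1" by (simp only: one_image)
      moreover have "id \<in> ?K"
        using subgroup.one_closed[OF subgroup_K] by (simp only: sym_group_one)
      ultimately show False using fg f1 p_mem by (simp add: act_\<sigma>)
    qed
    have "frobenius_action image_group {1..p} act"
      unfolding frobenius_action_def
    proof (intro conjI ballI impI)
      show "\<exists>g\<in>carrier image_group - {\<one>\<^bsub>image_group\<^esub>}. \<exists>x\<in>{1..p}. act g x = x"
        using fg f_ne fixed[OF fg(1) p_mem(1)] fp p_mem(1)
        by (intro bexI[of _ "\<sigma> ?f"] bexI[of _ p]) simp_all
    next
      fix g x y
      assume g: "g \<in> carrier image_group - {\<one>\<^bsub>image_group\<^esub>}" and x: "x \<in> {1..p}" and y: "y \<in> {1..p}"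
        and eq: "act g x = x \<and> act g y = y"
      obtain f where f: "f \<in> ?K" "g = \<sigma> f" using g by auto
      obtain c b where cb: "f = square_affine p c b" using f(1) by (auto simp: square_affine_group_def)
      show "x = y"
      proof (rule ccontr)
        assume "x \<noteq> y"
        then have "f = id"
          using eq fixed[OF f(1) x] fixed[OF f(1) y]
          unfolding cb f(2) by (intro square_affine_two_fixed_points[OF prime x y]) simp_all
        then show False using g f(2) one_image by simp
      qed
    qed (use faithful_action transitive in auto)
    then show "frobenius_group image_group" unfolding frobenius_group_def by blast
    show "\<not> comm_group image_group"
    proof
      assume "comm_group image_group"
      then interpret I: comm_group image_group .
      have "\<sigma> ?f \<otimes>\<^bsub>Q\<^esub> \<sigma> ?g = \<sigma> ?g \<otimes>\<^bsub>Q\<^esub> \<sigma> ?f"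
        using I.m_comm[of "\<sigma> ?f" "\<sigma> ?g"] fg by simp
      then have "\<sigma> (?f \<circ> ?g) = \<sigma> (?g \<circ> ?f)"
        using \<sigma>.hom_mult[of ?f ?g] \<sigma>.hom_mult[of ?g ?f] fg by (simp add: sym_group_mult)
      moreover have "?f \<circ> ?g \<in> ?K" "?g \<circ> ?f \<in> ?K"
        using subgroup.m_closed[OF subgroup_K] fg by (auto simp: sym_group_mult)
      ultimately have "?f \<circ> ?g = ?g \<circ> ?f" by (rule inj_onD[OF inj])
      from fun_cong[OF this, of p] have "?f (?g p) = ?g (?f p)" by simp
      then show False using f1 fp gp by simp
    qed
  qed
  have degenerate: "degenerate_frobenius_group image_group" if "p = 3"
  proof -
    have "stabilizer image_group act x = {\<one>\<^bsub>image_group\<^esub>}" if x: "x \<in> {1..p}" for x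
    proof
      show "stabilizer image_group act x \<subseteq> {\<one>\<^bsub>image_group\<^esub>}"
      proof
        fix g assume "g \<in> stabilizer image_group act x"
        then obtain f where f: "f \<in> ?K" "g = \<sigma> f" "act (\<sigma> f) x = x" by (auto simp: stabilizer_def)
        obtain c b where cb: "f = square_affine p c b" "\<not> int p dvd c"
          using f(1) by (auto simp: square_affine_group_def)
        \<comment> \<open>The only nonzero square modulo 3 is \<open>1\<close>, so all maps in the
          group are translations.\<close>
        have "c mod 3 = 1 \<or> c mod 3 = 2" using cb(2) \<open>p = 3\<close> by presburger
        then have "(c mod 3)\<^sup>2 mod 3 = 1" by auto
        then have "[c\<^sup>2 = 1] (mod int p)"
          using \<open>p = 3\<close> by (simp add: cong_def power_mod)
        then have "f = id"
          using square_affine_fixed_point[OF prime x] fixed[OF f(1) x] f(3) cb(1) by simp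
        then show "g \<in> {\<one>\<^bsub>image_group\<^esub>}" using f(2) one_image by simp
      qed
      show "{\<one>\<^bsub>image_group\<^esub>} \<subseteq> stabilizer image_group act x"
        using group_action.stabilizer_one_closed[OF faithful_action.axioms(1)[OF faithful_action] x] by simp
    qed
    then have "regular_action image_group {1..p} act"
      unfolding regular_action_def using faithful_action transitive p_mem by auto
    then show ?thesis unfolding degenerate_frobenius_group_def by blast
  qed
  have "p = 3 \<or> p > 3" using assms(2) by presburger
  then show ?thesis
    using subgroup_image order frob degenerate by (intro exI[of _ ?H]) auto
qed

end
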